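(* The Graph Motif problem can be solved in time $O(2^{k}\cdot \sqrt{|V|}\,|E|)$ on graphs $G=(V,E)$ of neighborhood diversity at most $k$.
   Context: Graph Motif problem: the input is an undirected graph $G=(V,E)$ together with a (not necessarily proper) vertex coloring, i.e. an arbitrary assignment of a color to each vertex, and a multiset $M$ of colors. The question is whether there exists a connected subgraph $B$ of $G$ such that the multiset of colors occurring on the vertices of $B$ is identical to $M$. Two vertices $v,v'$ of a graph $G$ have the same type iff $N(v)\setminus\{v'\}=N(v')\setminus\{v\}$, where $N(v)$ denotes the neighborhood of $v$. A graph $G=(V,E)$ has neighborhood diversity at most $w$ if there exists a partition of $V$ into at most $w$ sets such that all vertices in each set have the same type.
   Formalization: The literal bound fails for graphs with few edges (for E = ∅ it says time 0), so it is asserted for nonempty graphs without isolated vertices; for all graphs the bound is O(2^k·√|V|·|E| + |V| + 1). *)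

theory Defs
  imports Complex_Main "HOL-Library.Multiset" "HOL-Library.Disjoint_Sets"
begin

section \<open>Graphs, neighborhood diversity and Graph Motif\<close>

definition simple_graph :: "'v set \<Rightarrow> 'v set set \<Rightarrow> bool" where
  "simple_graph V E \<longleftrightarrow> finite V \<and> E \<subseteq> {{u, v} | u v. u \<in> V \<and> v \<in> V \<and> u \<noteq> v}"

definition neighborhood :: "'v set set \<Rightarrow> 'v \<Rightarrow> 'v set" where
  "neighborhood E v = {u. {u, v} \<in> E}"

definition same_type :: "'v set set \<Rightarrow> 'v \<Rightarrow> 'v \<Rightarrow> bool" where
  "same_type E u v \<longleftrightarrow> neighborhood E u - {v} = neighborhood E v - {u}"

definition neighborhood_diversity_at_most :: "'v set \<Rightarrow> 'v set set \<Rightarrow> nat \<Rightarrow> bool" where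
  "neighborhood_diversity_at_most V E w \<longleftrightarrow>
     (\<exists>P. partition_on V P \<and> card P \<le> w \<and> (\<forall>S\<in>P. \<forall>u\<in>S. \<forall>v\<in>S. same_type E u v))"

text \<open>
  With isolated vertices, \<open>sqrt |V| * |E|\<close> can be smaller than the time needed to inspect the colors
  of all vertices (for instance if \<open>E = {}\<close>), so a bound of this form needs \<open>|V| = O(|E|)\<close> or an
  additional term linear in \<open>|V|\<close>.
\<close>

definition no_isolated_vertices :: "'v set \<Rightarrow> 'v set set \<Rightarrow> bool" where
  "no_isolated_vertices V E \<longleftrightarrow> (\<forall>v\<in>V. neighborhood E v \<noteq> {})"

definition is_subgraph :: "'v set \<Rightarrow> 'v set set \<Rightarrow> 'v set \<Rightarrow> 'v set set \<Rightarrow> bool" where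
  "is_subgraph W F V E \<longleftrightarrow> simple_graph W F \<and> W \<subseteq> V \<and> F \<subseteq> E"

text \<open>The graph without vertices does not count as connected.\<close>

definition connected_graph :: "'v set \<Rightarrow> 'v set set \<Rightarrow> bool" where
  "connected_graph V E \<longleftrightarrow>
     V \<noteq> {} \<and> (\<forall>u\<in>V. \<forall>v\<in>V. (u, v) \<in> {(x, y). {x, y} \<in> E}\<^sup>*)"

definition graph_motif :: "'v set \<Rightarrow> 'v set set \<Rightarrow> ('v \<Rightarrow> 'c) \<Rightarrow> 'c multiset \<Rightarrow> bool" where
  "graph_motif V E col M \<longleftrightarrow>
     (\<exists>W F. is_subgraph W F V E \<and> connected_graph W F \<and> image_mset col (mset_set W) = M)"


section \<open>A unit-cost random access machine\<close>

text \<open>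
  The model of computation is a random access machine programmed in a structured language.
  Its memory consists of named arrays of natural numbers; a program mentions only finitely many of
  them, so they could be interleaved into a single memory with a constant-factor loss. Indices are
  computed values (indirect addressing). A scalar variable is an array used at index 0.
  As usual for the unit-cost measure, the arithmetic operations are addition and (truncated)
  subtraction only; there is no multiplication, which could build up long numbers too fast.
  Running time counts every evaluated expression node and every executed command.
\<close>

type_synonym vname = string
type_synonym state = "vname \<Rightarrow> nat \<Rightarrow> nat"

datatype aexp = N nat | Get vname aexp | Plus aexp aexp | Minus aexp aexp

datatype bexp = Less aexp aexp | Equal aexp aexp | Neg bexp | Conj bexp bexp

datatype com =
    Skip
  | Put vname aexp aexp
  | Seq com com
  | IfElse bexp com com
  | While bexp com

fun aval :: "aexp \<Rightarrow> state \<Rightarrow> nat" where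
  "aval (N n) s = n"
| "aval (Get x i) s = s x (aval i s)"
| "aval (Plus a b) s = aval a s + aval b s"
| "aval (Minus a b) s = aval a s - aval b s"

fun acost :: "aexp \<Rightarrow> nat" where
  "acost (N n) = 1"
| "acost (Get x i) = 1 + acost i"
| "acost (Plus a b) = 1 + acost a + acost b"
| "acost (Minus a b) = 1 + acost a + acost b"

fun bval :: "bexp \<Rightarrow> state \<Rightarrow> bool" where
  "bval (Less a b) s \<longleftrightarrow> aval a s < aval b s"
| "bval (Equal a b) s \<longleftrightarrow> aval a s = aval b s"
| "bval (Neg b) s \<longleftrightarrow> \<not> bval b s"
| "bval (Conj a b) s \<longleftrightarrow> bval a s \<and> bval b s"

fun bcost :: "bexp \<Rightarrow> nat" where
  "bcost (Less a b) = 1 + acost a + acost b"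
| "bcost (Equal a b) = 1 + acost a + acost b"
| "bcost (Neg b) = 1 + bcost b"
| "bcost (Conj a b) = 1 + bcost a + bcost b"

text \<open>\<open>runs c s t s'\<close>: started in \<open>s\<close>, the program \<open>c\<close> halts in state \<open>s'\<close> after \<open>t\<close> steps.\<close>

inductive runs :: "com \<Rightarrow> state \<Rightarrow> nat \<Rightarrow> state \<Rightarrow> bool" where
  Skip: "runs Skip s 1 s"
| Put: "runs (Put x i a) s (1 + acost i + acost a) (s(x := (s x)(aval i s := aval a s)))"
| Seq: "runs c s t s' \<Longrightarrow> runs d s' t' s'' \<Longrightarrow> runs (Seq c d) s (1 + t + t') s''"
| IfTrue: "bval b s \<Longrightarrow> runs c s t s' \<Longrightarrow> runs (IfElse b c d) s (1 + bcost b + t) s'"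
| IfFalse: "\<not> bval b s \<Longrightarrow> runs d s t s' \<Longrightarrow> runs (IfElse b c d) s (1 + bcost b + t) s'"
| WhileFalse: "\<not> bval b s \<Longrightarrow> runs (While b c) s (1 + bcost b) s"
| WhileTrue: "bval b s \<Longrightarrow> runs c s t s' \<Longrightarrow> runs (While b c) s' t' s'' \<Longrightarrow>
    runs (While b c) s (1 + bcost b + t + t') s''"

inductive_cases runs_SkipE: "runs Skip s t s'"
inductive_cases runs_PutE: "runs (Put x i a) s t s'"
inductive_cases runs_SeqE: "runs (Seq c d) s t s'"
inductive_cases runs_IfElseE: "runs (IfElse b c d) s t s'"
inductive_cases runs_WhileE: "runs (While b c) s t s'"

lemma runs_deterministic:
  assumes "runs c s t s'" "runs c s u r"
  shows "t = u \<and> s' = r"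
  using assms
proof (induction arbitrary: u r rule: runs.induct)
  case (Skip s)
  then show ?case by (auto elim: runs_SkipE)
next
  case (Put x i a s)
  then show ?case by (auto elim: runs_PutE)
next
  case (Seq c s t s' d t' s'')
  from Seq.prems obtain t1 s1 t2 where "runs c s t1 s1" "runs d s1 t2 r" "u = 1 + t1 + t2"
    by (auto elim: runs_SeqE)
  then show ?case using Seq.IH by metis
next
  case (IfTrue b s c t s' d)
  from IfTrue.prems IfTrue.hyps obtain t1 where "runs c s t1 r" "u = 1 + bcost b + t1"
    by (auto elim: runs_IfElseE)
  then show ?case using IfTrue.IH by metis
next
  case (IfFalse b s d t s' c)
  from IfFalse.prems IfFalse.hyps obtain t1 where "runs d s t1 r" "u = 1 + bcost b + t1"
    by (auto elim: runs_IfElseE)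
  then show ?case using IfFalse.IH by metis
next
  case (WhileFalse b s c)
  then show ?case by (auto elim: runs_WhileE)
next
  case (WhileTrue b s c t s' t' s'')
  from WhileTrue.prems WhileTrue.hyps obtain t1 s1 t2
    where "runs c s t1 s1" "runs (While b c) s1 t2 r" "u = 1 + bcost b + t1 + t2"
    by (auto elim: runs_WhileE)
  then show ?case using WhileTrue.IH by metis
qed


section \<open>Input encoding\<close>

text \<open>
  The vertices are numbered \<open>0, ..., n - 1\<close>. The graph is given by adjacency lists (in any order),
  the coloring by the list of the colors of the vertices, the multiset of colors by a list of its
  elements with repetition (in any order).
\<close>

definition encodes ::
  "nat list list \<Rightarrow> nat list \<Rightarrow> nat list \<Rightarrow>
   nat set \<Rightarrow> nat set set \<Rightarrow> (nat \<Rightarrow> nat) \<Rightarrow> nat multiset \<Rightarrow> bool" where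
  "encodes adj cs ms V E col M \<longleftrightarrow>
     V = {..<length adj} \<and>
     (\<forall>v<length adj. distinct (adj ! v) \<and> set (adj ! v) = neighborhood E v) \<and>
     cs = map col [0..<length adj] \<and>
     mset ms = M"

definition array :: "nat list \<Rightarrow> nat \<Rightarrow> nat" where
  "array xs i = (if i < length xs then xs ! i else 0)"

text \<open>
  In memory the adjacency lists are concatenated in \<open>adj\<close>; the list of vertex \<open>v\<close> occupies the
  indices from \<open>off[v]\<close> (inclusive) to \<open>off[v + 1]\<close> (exclusive). All other cells are 0.
  A program answers through the scalar \<open>out\<close>: 1 for yes, 0 for no.
\<close>

definition input_state :: "nat list list \<Rightarrow> nat list \<Rightarrow> nat list \<Rightarrow> state" where
  "input_state adj cs ms =
     (\<lambda>x i. 0)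
       (''n'' := array [length adj],
        ''off'' := array (map (\<lambda>v. sum_list (map length (take v adj))) [0..<Suc (length adj)]),
        ''adj'' := array (concat adj),
        ''col'' := array cs,
        ''msize'' := array [length ms],
        ''motif'' := array ms)"

end

theory Submission
  imports Defs "HOL-Library.Nat_Bijection"
begin

text \<open>
  Whether a set \<open>W\<close> of at least two vertices is connected depends only on the set \<open>S\<close> of types
  it meets. A set \<open>W\<close> that meets exactly the types in \<open>S\<close> and has color multiset \<open>M\<close> exists
  iff the vertices of these types carry all colors of \<open>M\<close> with multiplicity and the types have
  a system of representatives with colors in \<open>M\<close>. By Hall's theorem the latter can be replaced by
  \<open>|J| \<le> |M \<inter> colors J|\<close> for all \<open>J \<subseteq> S\<close>, so no matching has to be computed:
  this condition and connectedness both follow by dynamic programming from the sets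
  \<open>S - {i}\<close>, in time \<open>O(|E|)\<close> per set. The total is even \<open>O(2^k * |E| + |V|)\<close>.
  Isolated vertices only matter if \<open>|M| = 1\<close>; otherwise they are dropped, which is what makes
  the cost per set \<open>O(|E|)\<close>.
\<close>

section \<open>Hall's theorem and twin classes\<close>

text \<open>Representatives of the types suffice because of twins: once a suitable \<open>S\<close>
  is hit in every type, further vertices of these types preserve connectedness, so the rest of
  \<open>M\<close> can be filled up from them in any way. One number, the size of the part of
  \<open>M\<close> left uncovered by the colors of \<open>J\<close>, decides Hall's condition for
  \<open>J\<close> and, by being zero, whether these colors suffice for \<open>M\<close>. The
  machine shapes the rest. It is given neither a partition nor \<open>k\<close>: it groups twins
  itself and finds at most \<open>k\<close> classes, because representatives of different types lie
  in different blocks of any partition. Without multiplication, division or bit operations, sets are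
  numbers whose bits are split off by subtracting powers of two; \<open>S - {i}\<close> has a
  smaller number than \<open>S\<close>, so counting upwards is a valid order for the recursion.
  Colors and \<open>M\<close> may be arbitrarily large, so arrays indexed by colors are never
  cleared as a whole, and a motif with at least two elements is compared in size with the graph
  before it is counted. The factor \<open>sqrt |V|\<close> enters the bound only through being at
  least 1 on nonempty graphs.\<close>

lemma hall_marriage:
  fixes A :: "'i \<Rightarrow> 'a set"
  assumes "finite I" "\<And>i. i \<in> I \<Longrightarrow> finite (A i)"
    and "\<And>J. J \<subseteq> I \<Longrightarrow> card J \<le> card (\<Union>(A ` J))"
  shows "\<exists>R. inj_on R I \<and> (\<forall>i\<in>I. R i \<in> A i)"
  using assms
proof (induction "card I" arbitrary: I A rule: less_induct)
  case less
  note fin = less.prems(1) and finA = less.prems(2) and hall = less.prems(3)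
  show ?case
  proof (cases "I = {}")
    case True
    then show ?thesis by simp
  next
    case False
    \<comment> \<open>If some proper nonempty \<open>J\<close> is tight, its indices use up all of
      \<open>?B\<close>, and the others are matched outside \<open>?B\<close>. Without a tight
      \<open>J\<close> every nonempty proper subfamily has an element to spare, so an arbitrary
      choice for one index does no harm.\<close>
    show ?thesis
    proof (cases "\<exists>J. J \<subset> I \<and> J \<noteq> {} \<and> card (\<Union>(A ` J)) = card J")
      case True
      then obtain J where J: "J \<subset> I" "J \<noteq> {}" "card (\<Union>(A ` J)) = card J" by blast
      let ?B = "\<Union>(A ` J)"
      have finJ: "finite J" using J fin by (meson finite_subset psubset_imp_subset)
      have finB: "finite ?B" using finJ J finA by blast
      have "\<exists>R. inj_on R J \<and> (\<forall>i\<in>J. R i \<in> A i)"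
        by (rule less.hyps) (use J fin finA hall finJ in \<open>auto simp: psubset_card_mono\<close>)
      then obtain R1 where R1: "inj_on R1 J" "\<forall>i\<in>J. R1 i \<in> A i" by blast
      have "\<exists>R. inj_on R (I - J) \<and> (\<forall>i\<in>I - J. R i \<in> A i - ?B)"
      proof (rule less.hyps)
        show "card (I - J) < card I"
          by (rule psubset_card_mono) (use fin J in auto)
        fix L assume L: "L \<subseteq> I - J"
        then have finL: "finite L" using fin by (meson Diff_subset finite_subset)
        have eq: "\<Union>((\<lambda>i. A i - ?B) ` L) = \<Union>(A ` (L \<union> J)) - ?B" by blast
        have "card L + card J = card (L \<union> J)"
          using L finL finJ by (subst card_Un_disjoint) auto
        also have "\<dots> \<le> card (\<Union>(A ` (L \<union> J)))" using L J by (intro hall) auto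
        finally have "card L + card J \<le> card (\<Union>(A ` (L \<union> J)))" .
        moreover have "card (\<Union>(A ` (L \<union> J)) - ?B) = card (\<Union>(A ` (L \<union> J))) - card ?B"
          using finB by (intro card_Diff_subset) auto
        \<comment> \<open>Tightness of \<open>J\<close> turns the bound for
          \<open>L \<union> J\<close> into the bound for \<open>L\<close> after \<open>?B\<close>
          has been taken away.\<close>
        ultimately show "card L \<le> card (\<Union>((\<lambda>i. A i - ?B) ` L))"
          unfolding eq J(3) by linarith
      qed (use fin finA in auto)
      then obtain R2 where R2: "inj_on R2 (I - J)" "\<forall>i\<in>I - J. R2 i \<in> A i - ?B" by blast
      let ?R = "\<lambda>i. if i \<in> J then R1 i else R2 i"
      have "inj_on ?R I"
      proof (rule inj_onI)
        fix x y assume xy: "x \<in> I" "y \<in> I" "?R x = ?R y"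
        have "R1 a \<noteq> R2 b" if "a \<in> J" "b \<in> I - J" for a b using R1(2) R2(2) that by fastforce
        then show "x = y"
          using xy R1(1) R2(1) by (cases "x \<in> J"; cases "y \<in> J") (auto dest: inj_onD, metis)
      qed
      moreover have "\<forall>i\<in>I. ?R i \<in> A i" using R1 R2 by auto
      ultimately show ?thesis by blast
    next
      case noTight: False
      from False obtain i where i: "i \<in> I" by blast
      have "card {i} \<le> card (\<Union>(A ` {i}))" using i by (intro hall) auto
      then obtain x where x: "x \<in> A i" by fastforce
      have "\<exists>R. inj_on R (I - {i}) \<and> (\<forall>j\<in>I - {i}. R j \<in> A j - {x})"
      proof (rule less.hyps)
        show "card (I - {i}) < card I" using fin i by (rule card_Diff1_less)
        fix J assume J: "J \<subseteq> I - {i}"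
        have eq: "\<Union>((\<lambda>j. A j - {x}) ` J) = \<Union>(A ` J) - {x}" by blast
        show "card J \<le> card (\<Union>((\<lambda>j. A j - {x}) ` J))"
        proof (cases "J = {}")
          case False
          have "J \<subset> I" using J i by blast
          then have "card J < card (\<Union>(A ` J))"
            using noTight False hall[of J] by (metis le_neq_implies_less psubset_imp_subset)
          moreover have "card (\<Union>(A ` J)) - 1 \<le> card (\<Union>(A ` J) - {x})"
            by (metis Diff_empty Diff_insert0 card_Diff_singleton diff_le_self order_refl)
          ultimately show ?thesis unfolding eq by linarith
        qed simp
      qed (use fin finA in auto)
      then obtain R where R: "inj_on R (I - {i})" "\<forall>j\<in>I - {i}. R j \<in> A j - {x}" by blast
      have "inj_on (R(i := x)) I"
      proof (rule inj_onI)
        fix a b assume "a \<in> I" "b \<in> I" "(R(i := x)) a = (R(i := x)) b"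
        then show "a = b"
          using R by (cases "a = i"; cases "b = i") (auto dest: inj_onD)
      qed
      moreover have "\<forall>j\<in>I. (R(i := x)) j \<in> A j" using R x by auto
      ultimately show ?thesis by blast
    qed
  qed
qed

section \<open>Color multisets of vertex sets\<close>

lemma count_image_mset_mset_set:
  assumes "finite A"
  shows "count (image_mset f (mset_set A)) c = card {v \<in> A. f v = c}"
  using assms
proof (induction A)
  case (insert a A)
  have "{v \<in> insert a A. f v = c} =
      (if f a = c then insert a {v \<in> A. f v = c} else {v \<in> A. f v = c})" by auto
  then show ?case using insert by simp
qed simp

text \<open>A preimage \<open>X\<close> of \<open>Y\<close> inside \<open>mset_set A\<close> has
  multiplicities at most one, so it comes from a set. This turns leftover colors of the motif into
  concrete vertices.\<close>

lemma sub_image_mset_set: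
  assumes "finite A" "Y \<subseteq># image_mset f (mset_set A)"
  shows "\<exists>B\<subseteq>A. image_mset f (mset_set B) = Y"
proof -
  from assms(2) obtain Z where "image_mset f (mset_set A) = Y + Z"
    unfolding mset_subset_eq_exists_conv by blast
  then obtain X X' where "mset_set A = X + X'" and Y: "Y = image_mset f X"
    using image_mset_eq_plusD by blast
  then have X: "X \<subseteq># mset_set A" by simp
  have le1: "count X x \<le> 1" for x
    using mset_subset_eq_count[OF X, of x] by (auto simp: count_mset_set' split: if_splits)
  have "X = mset_set (set_mset X)"
  proof (rule multiset_eqI)
    fix x
    show "count X x = count (mset_set (set_mset X)) x"
    proof (cases "x \<in># X")
      case True
      then show ?thesis using le1[of x] count_greater_zero_iff[of X x]
        by (simp add: count_mset_set' del: count_greater_zero_iff)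
    next
      case False
      then show ?thesis by (simp add: count_mset_set' not_in_iff)
    qed
  qed
  moreover have "set_mset X \<subseteq> A"
    using set_mset_mono[OF X] assms(1) by simp
  ultimately show ?thesis using Y by metis
qed

text \<open>
  The sets that can be built up by adding elements adjacent to earlier ones. Connectedness is
  used in this form because it satisfies a recurrence over the sets \<open>S - {i}\<close> (\<open>grown_iff\<close>).
\<close>

inductive grown :: "('i \<Rightarrow> 'i \<Rightarrow> bool) \<Rightarrow> 'i set \<Rightarrow> bool" for A where
  grown_empty: "grown A {}"
| grown_insert: "grown A S \<Longrightarrow> i \<notin> S \<Longrightarrow> S = {} \<or> (\<exists>j\<in>S. A i j) \<Longrightarrow> grown A (insert i S)"

lemma grown_iff:
  assumes "S \<noteq> {}"
  shows "grown A S \<longleftrightarrow> (\<exists>i\<in>S. grown A (S - {i}) \<and> (S = {i} \<or> (\<exists>j\<in>S - {i}. A i j)))"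
proof
  assume "grown A S"
  then show "\<exists>i\<in>S. grown A (S - {i}) \<and> (S = {i} \<or> (\<exists>j\<in>S - {i}. A i j))"
  proof cases
    case (grown_insert S' i)
    then have "S - {i} = S'" by blast
    then show ?thesis using grown_insert by blast
  qed (use assms in simp)
next
  assume "\<exists>i\<in>S. grown A (S - {i}) \<and> (S = {i} \<or> (\<exists>j\<in>S - {i}. A i j))"
  then obtain i where "i \<in> S" "grown A (S - {i})" "S = {i} \<or> (\<exists>j\<in>S - {i}. A i j)" by blast
  then show "grown A S"
    using grown_insert[of A "S - {i}" i] by (auto simp: insert_absorb)
qed

text \<open>A set that no edge leaves is closed under reachability. The last assumption keeps paths
  inside \<open>W\<close>.\<close>

lemma connected_crossing:
  assumes "connected_graph W F" "X \<subseteq> W" "X \<noteq> {}" "X \<noteq> W" "\<And>e. e \<in> F \<Longrightarrow> e \<subseteq> W"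
  shows "\<exists>u\<in>X. \<exists>v\<in>W - X. {u, v} \<in> F"
proof (rule ccontr)
  assume no: "\<not> ?thesis"
  obtain x y where xy: "x \<in> X" "y \<in> W - X" using assms by blast
  then have "(x, y) \<in> {(x, y). {x, y} \<in> F}\<^sup>*" using assms unfolding connected_graph_def by blast
  then have "y \<in> X"
  proof induction
    case (step a b)
    then show ?case using no assms(5)[of "{a, b}"] by auto
  qed (use xy in simp)
  then show False using xy by simp
qed

lemma connected_graph_edge:
  assumes "connected_graph W F" "\<And>e. e \<in> F \<Longrightarrow> e \<subseteq> W" "2 \<le> card W" "v \<in> W"
  shows "\<exists>u. {v, u} \<in> F"
proof -
  have "{v} \<noteq> W" using assms(3) by auto
  then show ?thesis using connected_crossing[OF assms(1), of "{v}"] assms(2,4) by auto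
qed

section \<open>Twins and twin classes\<close>

lemma same_type_refl [simp]: "same_type E u u"
  by (simp add: same_type_def)

lemma neighborhood_sym: "u \<in> neighborhood E v \<longleftrightarrow> v \<in> neighborhood E u"
  by (simp add: neighborhood_def insert_commute)

lemma same_type_swap:
  assumes "same_type E a b" "x \<noteq> a" "x \<noteq> b"
  shows "{a, x} \<in> E \<longleftrightarrow> {b, x} \<in> E"
proof -
  have "x \<in> neighborhood E a - {b} \<longleftrightarrow> x \<in> neighborhood E b - {a}"
    using assms(1) unfolding same_type_def by simp
  then show ?thesis using assms(2,3) by (simp add: neighborhood_def insert_commute)
qed

lemma same_typeI:
  assumes "{a} \<notin> E" "{b} \<notin> E" "\<And>x. x \<noteq> a \<Longrightarrow> x \<noteq> b \<Longrightarrow> {a, x} \<in> E \<longleftrightarrow> {b, x} \<in> E"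
  shows "same_type E a b"
proof -
  have "x \<in> neighborhood E a - {b} \<longleftrightarrow> x \<in> neighborhood E b - {a}" for x
  proof (cases "x = a \<or> x = b")
    case True
    then show ?thesis using assms(1,2) by (auto simp: neighborhood_def)
  next
    case False
    then show ?thesis using assms(3)[of x] by (simp add: neighborhood_def insert_commute)
  qed
  then show ?thesis unfolding same_type_def by blast
qed

lemma same_type_trans:
  assumes "same_type E a b" "same_type E b c" "\<And>x. {x} \<notin> E"
  shows "same_type E a c"
proof (cases "a = b \<or> b = c \<or> a = c")
  case False
  show ?thesis
  proof (rule same_typeI)
    fix x assume x: "x \<noteq> a" "x \<noteq> c"
    show "{a, x} \<in> E \<longleftrightarrow> {c, x} \<in> E"
    proof (cases "x = b")
      case True
      \<comment> \<open>\<open>{a, b}\<close> and \<open>{c, b}\<close> are compared through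
        \<open>{a, c}\<close>: each of the two twin relations exchanges one end point.\<close>
      then show ?thesis
        using same_type_swap[OF assms(1), of c] same_type_swap[OF assms(2), of a]
          \<open>\<not> (a = b \<or> b = c \<or> a = c)\<close> by (simp add: insert_commute eq_commute)
    next
      case False
      then show ?thesis
        using same_type_swap[OF assms(1), of x] same_type_swap[OF assms(2), of x] x by simp
    qed
  qed (use assms in auto)
qed (use assms in auto)

lemma same_type_sym: "same_type E a b \<Longrightarrow> same_type E b a"
  by (simp add: same_type_def)

text \<open>An abstract view of the arrays \<open>cls\<close> and \<open>rep\<close> that the
  program computes; \<open>U\<close> will be the set of nonisolated vertices. That different classes
  have different types matters for the bound on \<open>K\<close> and is kept apart, in
  \<open>classified\<close>.\<close>

locale twin_classes =
  fixes E :: "'v set set" and U :: "'v set" and cls :: "'v \<Rightarrow> nat" and rep :: "nat \<Rightarrow> 'v" and K :: nat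
  assumes finite_U: "finite U"
    and edge: "e \<in> E \<Longrightarrow> \<exists>u v. e = {u, v} \<and> u \<noteq> v \<and> u \<in> U \<and> v \<in> U"
    and cls_less: "v \<in> U \<Longrightarrow> cls v < K"
    and cls_rep: "v \<in> U \<Longrightarrow> same_type E (rep (cls v)) v"
    and rep_U: "i < K \<Longrightarrow> rep i \<in> U"
    and rep_cls: "i < K \<Longrightarrow> cls (rep i) = i"
begin

text \<open>Reading the relation off one representative lets a scan of one adjacency list decide it.
  The diagonal carries information: \<open>class_adj i i\<close> says that the class is a clique
  with at least two members.\<close>

definition class_adj :: "nat \<Rightarrow> nat \<Rightarrow> bool" where
  "class_adj i j \<longleftrightarrow> (\<exists>w\<in>neighborhood E (rep i). cls w = j)"

definition members :: "nat set \<Rightarrow> 'v set" where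
  "members S = {v \<in> U. cls v \<in> S}"

lemma no_loop: "{x} \<notin> E"
proof
  assume "{x} \<in> E"
  then obtain u v where "{x} = {u, v}" "u \<noteq> v" using edge by blast
  then show False by auto
qed

lemma edge_U: "{u, v} \<in> E \<Longrightarrow> u \<in> U \<and> v \<in> U \<and> u \<noteq> v"
  using edge[of "{u, v}"] by (auto simp: doubleton_eq_iff)

lemma same_class: "u \<in> U \<Longrightarrow> v \<in> U \<Longrightarrow> cls u = cls v \<Longrightarrow> same_type E u v"
  using same_type_trans[OF same_type_sym[OF cls_rep[of u]], of v] cls_rep[of v] no_loop by simp

text \<open>Twins can be exchanged as end points of an edge, so an edge at \<open>u\<close> moves to
  the representative of its class and back. The special cases arise when the other end point is
  itself one of the vertices exchanged.\<close>

lemma edge_iff_class_adj: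
  assumes "u \<in> U" "v \<in> U" "u \<noteq> v"
  shows "{u, v} \<in> E \<longleftrightarrow> class_adj (cls u) (cls v)"
proof
  let ?r = "rep (cls u)"
  have r: "?r \<in> U" "cls ?r = cls u" using assms cls_less rep_U rep_cls by auto
  have ru: "same_type E ?r u" using cls_rep assms by blast
  {
    assume e: "{u, v} \<in> E"
    show "class_adj (cls u) (cls v)"
    proof (cases "v = ?r")
      case True
      then have "u \<in> neighborhood E ?r" using e by (simp add: neighborhood_def)
      then show ?thesis using True r unfolding class_adj_def by metis
    next
      case False
      then have "{?r, v} \<in> E" using same_type_swap[OF ru, of v] e assms by auto
      then have "v \<in> neighborhood E ?r" by (simp add: neighborhood_def insert_commute)
      then show ?thesis unfolding class_adj_def by blast
    qed
  next
    assume "class_adj (cls u) (cls v)"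
    then obtain w where w: "{?r, w} \<in> E" "cls w = cls v"
      unfolding class_adj_def neighborhood_def by (auto simp: insert_commute)
    have wU: "w \<in> U" "w \<noteq> ?r" using edge_U[OF w(1)] by auto
    have wv: "same_type E w v" using same_class wU w assms by auto
    show "{u, v} \<in> E"
    proof (cases "w = u")
      case True
      \<comment> \<open>The edge found joins \<open>?r\<close> to \<open>u\<close> itself. Now
        \<open>u\<close>, \<open>v\<close> and \<open>?r\<close> share a class, and replacing
        \<open>?r\<close> by its twin \<open>v\<close> gives the edge wanted.\<close>
      then have "cls u = cls v" using w by simp
      then have rv: "same_type E ?r v" using same_class r assms by auto
      then show ?thesis
        using same_type_swap[OF rv, of u] w True wU assms by (auto simp: insert_commute)
    next
      case False
      then have "{u, w} \<in> E" using same_type_swap[OF ru, of w] w wU by auto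
      then show ?thesis
        using same_type_swap[OF wv, of u] False assms by (auto simp: insert_commute)
    qed
  }
qed

text \<open>With \<open>X\<close> the colors of the classes in \<open>J\<close>,
  \<open>size (M - X)\<close> equals \<open>|M| - |M \<inter> X|\<close>, so this is Hall's
  condition in additive form. The program maintains the deficiency \<open>size (M - X)\<close>; its
  vanishing for \<open>J = S\<close> is the second condition in \<open>accepts\<close>.\<close>

definition feasible :: "('v \<Rightarrow> 'c) \<Rightarrow> 'c multiset \<Rightarrow> nat set \<Rightarrow> bool" where
  "feasible col M S \<longleftrightarrow>
     (\<forall>J\<subseteq>S. card J + size (M - image_mset col (mset_set (members J))) \<le> size M)"

text \<open>
  The case \<open>S = {i}\<close> demands that the class is a clique: a single class is used with at least
  two vertices here.
\<close>

definition linked :: "nat set \<Rightarrow> bool" where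
  "linked S \<longleftrightarrow> (\<exists>i\<in>S. grown class_adj (S - {i}) \<and> (\<exists>j\<in>S. class_adj i j \<and> (j \<noteq> i \<or> S = {i})))"

definition accepts :: "('v \<Rightarrow> 'c) \<Rightarrow> 'c multiset \<Rightarrow> nat set \<Rightarrow> bool" where
  "accepts col M S \<longleftrightarrow>
     feasible col M S \<and> M \<subseteq># image_mset col (mset_set (members S)) \<and> linked S"

lemma finite_members [simp]: "finite (members S)"
  using finite_U by (simp add: members_def)

text \<open>Every proper subset of \<open>S\<close> misses some \<open>i\<close>, so
  \<open>J = S\<close> is the only instance that the sets \<open>S - {i}\<close> do not cover. This
  is the recurrence behind the table \<open>hallt\<close>.\<close>

lemma feasible_iff:
  assumes "finite S"
  shows "feasible col M S \<longleftrightarrow>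
    card S + size (M - image_mset col (mset_set (members S))) \<le> size M \<and>
    (\<forall>i\<in>S. feasible col M (S - {i}))"
proof safe
  assume R: "card S + size (M - image_mset col (mset_set (members S))) \<le> size M"
    "\<forall>i\<in>S. feasible col M (S - {i})"
  show "feasible col M S"
    unfolding feasible_def
  proof safe
    fix J assume "J \<subseteq> S"
    show "card J + size (M - image_mset col (mset_set (members J))) \<le> size M"
    proof (cases "J = S")
      case False
      then obtain i where "i \<in> S" "J \<subseteq> S - {i}" using \<open>J \<subseteq> S\<close> by blast
      then show ?thesis using R(2) unfolding feasible_def by blast
    qed (use R in simp)
  qed
qed (auto simp: feasible_def)

text \<open>The vertices of \<open>W\<close> in the classes of \<open>J\<close> number at least
  \<open>card J\<close>, and their colors are covered by those classes; so at most
  \<open>card W - card ?W\<close> elements of \<open>M\<close> remain uncovered.\<close>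

lemma feasible_necessary:
  assumes "W \<subseteq> U" "image_mset col (mset_set W) = M"
  shows "feasible col M (cls ` W)"
  unfolding feasible_def
proof safe
  fix J assume J: "J \<subseteq> cls ` W"
  let ?W = "W \<inter> members J"
  have finW: "finite W" using assms finite_U finite_subset by blast
  have "image_mset col (mset_set ?W) \<subseteq># image_mset col (mset_set (members J))"
    by (intro image_mset_subseteq_mono subset_imp_msubset_mset_set) auto
  then have "size (M - image_mset col (mset_set (members J))) \<le>
      size (M - image_mset col (mset_set ?W))"
    by (intro size_mset_mono mset_subset_eqI) (simp add: diff_le_mono2 mset_subset_eq_count)
  also have "\<dots> = card W - card ?W"
  proof -
    have "image_mset col (mset_set ?W) \<subseteq># M"
      unfolding assms(2)[symmetric]
      by (intro image_mset_subseteq_mono subset_imp_msubset_mset_set) (auto simp: finW)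
    then show ?thesis
      using assms(2) by (subst size_Diff_submset) auto
  qed
  finally have *: "size (M - image_mset col (mset_set (members J))) \<le> card W - card ?W" .
  have "J \<subseteq> cls ` ?W" using J assms(1) by (auto simp: members_def)
  then have "card J \<le> card ?W" using finW by (meson finite_Int surj_card_le)
  moreover have "card ?W \<le> card W" using finW by (intro card_mono) auto
  moreover have "card W = size M" using assms(2) by auto
  ultimately show "card J + size (M - image_mset col (mset_set (members J))) \<le> size M"
    using * by linarith
qed

lemma feasible_sufficient:
  fixes col :: "'v \<Rightarrow> 'c"
  assumes "feasible col M S" "M \<subseteq># image_mset col (mset_set (members S))" "finite S"
  shows "\<exists>W\<subseteq>U. cls ` W = S \<and> image_mset col (mset_set W) = M"
proof -
  define A where "A i = (SIGMA c:col ` members {i}. {..<count M c})" for i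
  have UA: "\<Union>(A ` J) = (SIGMA c:col ` members J. {..<count M c})" for J
    by (auto simp: A_def members_def)
  have "\<exists>R. inj_on R S \<and> (\<forall>i\<in>S. R i \<in> A i)"
  proof (rule hall_marriage)
    fix J assume J: "J \<subseteq> S"
    let ?X = "image_mset col (mset_set (members J))"
    \<comment> \<open>Passing from \<open>M \<inter># ?X\<close> to all copies of the colors that
      occur in \<open>J\<close> can only enlarge the count, so \<open>feasible\<close> implies
      Hall's condition for \<open>A\<close>.\<close>
    have "size M - size (M - ?X) \<le> size (M \<inter># ?X)"
      by (metis diff_le_self inter_mset_def size_Diff_submset diff_subset_eq_self order_refl)
    also have "\<dots> = (\<Sum>c\<in>set_mset (M \<inter># ?X). count (M \<inter># ?X) c)"
      by (simp only: size_multiset_overloaded_eq)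
    also have "\<dots> \<le> (\<Sum>c\<in>set_mset (M \<inter># ?X). count M c)"
      by (intro sum_mono) simp
    also have "\<dots> \<le> (\<Sum>c\<in>col ` members J. count M c)"
      by (intro sum_mono2) auto
    also have "\<dots> = card (\<Union>(A ` J))"
      unfolding UA by (subst card_SigmaI) auto
    finally have "size M - size (M - ?X) \<le> card (\<Union>(A ` J))" .
    moreover have "card J + size (M - ?X) \<le> size M"
      using assms(1) J unfolding feasible_def by blast
    ultimately show "card J \<le> card (\<Union>(A ` J))" by linarith
  qed (use assms in \<open>auto simp: A_def\<close>)
  then obtain R where R: "inj_on R S" "\<forall>i\<in>S. R i \<in> A i" by blast
  have "\<forall>i\<in>S. \<exists>v\<in>U. cls v = i \<and> col v = fst (R i)"
  proof
    fix i assume "i \<in> S"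
    then have "R i \<in> A i" using R(2) by blast
    then show "\<exists>v\<in>U. cls v = i \<and> col v = fst (R i)"
      by (auto simp: A_def members_def)
  qed
  then obtain g where g: "\<forall>i\<in>S. g i \<in> U \<and> cls (g i) = i \<and> col (g i) = fst (R i)" by metis
  have injg: "inj_on g S" using g by (metis inj_onI)
  let ?W0 = "g ` S"
  have W0: "?W0 \<subseteq> members S" using g by (auto simp: members_def)
  have cnt: "count (image_mset col (mset_set ?W0)) c \<le> count M c" for c
  proof -
    have "count (image_mset col (mset_set ?W0)) c = card {i \<in> S. fst (R i) = c}"
    proof -
      have "count (image_mset col (mset_set ?W0)) c = card {v \<in> ?W0. col v = c}"
        using assms(3) by (simp add: count_image_mset_mset_set)
      also have "{v \<in> ?W0. col v = c} = g ` {i \<in> S. fst (R i) = c}" using g by auto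
      also have "card \<dots> = card {i \<in> S. fst (R i) = c}"
        by (intro card_image inj_on_subset[OF injg]) auto
      finally show ?thesis .
    qed
    also have "\<dots> = card (R ` {i \<in> S. fst (R i) = c})"
      by (rule card_image[symmetric]) (rule inj_on_subset[OF R(1)], auto)
    also have "\<dots> \<le> card ({c} \<times> {..<count M c})"
      by (intro card_mono) (use R(2) in \<open>force simp: A_def\<close>)+
    finally show ?thesis by simp
  qed
  have split: "image_mset col (mset_set (members S)) =
      image_mset col (mset_set ?W0) + image_mset col (mset_set (members S - ?W0))"
    using W0 assms(3) by (subst mset_set_Diff) (auto simp flip: image_mset_union
      simp: subset_imp_msubset_mset_set)
  have "M - image_mset col (mset_set ?W0) \<subseteq># image_mset col (mset_set (members S - ?W0))"
    using assms(2) unfolding split by (simp add: subset_eq_diff_conv add.commute)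
  then have "\<exists>W1\<subseteq>members S - ?W0. image_mset col (mset_set W1) = M - image_mset col (mset_set ?W0)"
    by (intro sub_image_mset_set finite_Diff finite_members)
  then obtain W1 where W1: "W1 \<subseteq> members S - ?W0"
    "image_mset col (mset_set W1) = M - image_mset col (mset_set ?W0)"
    by (elim exE conjE)
  have finW1: "finite W1" using W1 finite_members by (meson finite_Diff finite_subset)
  have "image_mset col (mset_set (?W0 \<union> W1)) = M"
    using W1 finW1 assms(3) cnt
    by (subst mset_set_Union) (auto simp: mset_subset_eqI)
  moreover have "?W0 \<union> W1 \<subseteq> U" "cls ` (?W0 \<union> W1) \<subseteq> S"
    using g W1(1) by (auto simp: members_def)
  moreover have "S \<subseteq> cls ` ?W0"
    using g by (force simp: image_image)
  ultimately show ?thesis by (intro exI[of _ "?W0 \<union> W1"]) blast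
qed

text \<open>Take a largest grown proper subset \<open>C\<close> of the classes. If \<open>C\<close>
  is nonempty, connectedness supplies an edge leaving the classes in \<open>C\<close>, and by
  maximality the class at its other end completes the set.\<close>

lemma linked_necessary:
  assumes con: "connected_graph W F" and F: "F \<subseteq> E" "\<And>e. e \<in> F \<Longrightarrow> e \<subseteq> W"
    and W: "W \<subseteq> U" "2 \<le> card W"
  shows "linked (cls ` W)"
proof -
  let ?S = "cls ` W"
  have finW: "finite W" using W by (metis card.infinite not_numeral_le_zero)
  have "W \<noteq> {}" using W by auto
  let ?P = "\<lambda>C. C \<subset> ?S \<and> grown class_adj C"
  have "?P {}" using \<open>W \<noteq> {}\<close> by (auto intro: grown_empty)
  moreover have "\<forall>C. ?P C \<longrightarrow> card C \<le> card ?S"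
    using finW by (auto intro: card_mono)
  ultimately obtain C where C: "?P C" "\<And>D. ?P D \<Longrightarrow> card D \<le> card C"
    using ex_has_greatest_nat[of ?P "{}" card "Suc (card ?S)"] by (metis le_imp_less_Suc)
  have finC: "finite C" using C finW by (meson finite_imageI finite_subset psubset_imp_subset)
  \<comment> \<open>By maximality of \<open>C\<close>, a single further class completes it.\<close>
  have max: "insert i C = ?S" if "i \<in> ?S" "i \<notin> C" "C = {} \<or> (\<exists>j\<in>C. class_adj i j)" for i
  proof (rule ccontr)
    assume "insert i C \<noteq> ?S"
    then have "insert i C \<subset> ?S" using that(1) C(1) by blast
    moreover have "grown class_adj (insert i C)" using C(1) that(2,3) by (simp add: grown_insert)
    ultimately have "card (insert i C) \<le> card C" using C(2) by blast
    then show False using finC that(2) by simp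
  qed
  show ?thesis
  proof (cases "C = {}")
    \<comment> \<open>Here \<open>W\<close> lies in one class; being connected with two vertices, it
      contains an edge, which makes that class adjacent to itself.\<close>
    case True
    obtain v where v: "v \<in> W" using \<open>W \<noteq> {}\<close> by blast
    then have S: "?S = {cls v}" using max[of "cls v"] True by auto
    obtain u where u: "{v, u} \<in> F" "u \<in> W"
      using connected_graph_edge[OF con F(2) W(2) v] F(2) by blast
    then have "{v, u} \<in> E" using F by blast
    then have "class_adj (cls v) (cls u)"
      using edge_iff_class_adj[of v u] edge_U by blast
    moreover have "cls u = cls v" using S u by blast
    ultimately show ?thesis
      unfolding linked_def S by (auto intro: grown_empty)
  next
    case False
    let ?X = "{w \<in> W. cls w \<in> C}"
    have "?X \<noteq> {}" "?X \<noteq> W" using C(1) False by blast+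
    then obtain u v where uv: "u \<in> ?X" "v \<in> W - ?X" "{u, v} \<in> F"
      using connected_crossing[OF con, of ?X] F by blast
    then have "{v, u} \<in> E" using F by (auto simp: insert_commute)
    then have adj: "class_adj (cls v) (cls u)"
      using edge_iff_class_adj[of v u] edge_U by blast
    have S: "insert (cls v) C = ?S" using max[of "cls v"] uv adj by blast
    have "?S - {cls v} = C" using S uv by auto
    moreover have "cls u \<in> ?S" "cls v \<in> ?S" "cls u \<noteq> cls v" using uv by auto
    ultimately show ?thesis
      unfolding linked_def using adj C(1) by (intro bexI[of _ "cls v"] conjI bexI[of _ "cls u"]) simp_all
  qed
qed

text \<open>When \<open>g\<close> chooses one vertex per class, adjacency of the chosen vertices is
  given by \<open>class_adj\<close>, so each class added during growth is joined by an edge to an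
  earlier choice.\<close>

lemma grown_reach:
  assumes "grown class_adj S" "\<And>i. i \<in> S \<Longrightarrow> g i \<in> U \<and> cls (g i) = i" "i \<in> S" "j \<in> S"
  shows "(g i, g j) \<in> {(x, y). {x, y} \<in> E \<and> x \<in> g ` S \<and> y \<in> g ` S}\<^sup>*"
  using assms
proof (induction arbitrary: i j rule: grown.induct)
  case (grown_insert S k)
  let ?R = "\<lambda>S. {(x, y). {x, y} \<in> E \<and> x \<in> g ` S \<and> y \<in> g ` S}"
  have mono: "(?R S)\<^sup>* \<subseteq> (?R (insert k S))\<^sup>*" by (intro rtrancl_mono) auto
  have IH: "(g i, g j) \<in> (?R (insert k S))\<^sup>*" if "i \<in> S" "j \<in> S" for i j
    using grown_insert.IH[OF _ that] grown_insert.prems(1) mono by auto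
  show ?case
  proof (cases "S = {}")
    case False
    then obtain l where l: "l \<in> S" "class_adj k l" using grown_insert.hyps by blast
    have g: "g k \<in> U" "cls (g k) = k" "g l \<in> U" "cls (g l) = l"
      using grown_insert.prems(1) l by auto
    have "g k \<noteq> g l" using g l grown_insert.hyps by metis
    then have "{g k, g l} \<in> E" using edge_iff_class_adj g l by auto
    then have kl: "(g k, g l) \<in> (?R (insert k S))\<^sup>*" "(g l, g k) \<in> (?R (insert k S))\<^sup>*"
      using l by (auto simp: insert_commute)
    have "(g i, g l) \<in> (?R (insert k S))\<^sup>*"
      using grown_insert.prems(2) kl(1) IH[of i l] l(1) by blast
    moreover have "(g l, g j) \<in> (?R (insert k S))\<^sup>*"
      using grown_insert.prems(3) kl(2) IH[of l j] l(1) by blast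
    ultimately show ?thesis by (rule rtrancl_trans)
  next
    case True
    then show ?thesis using grown_insert.prems(2,3) by simp
  qed
qed simp

lemma linked_grown: "linked S \<Longrightarrow> grown class_adj S"
  unfolding linked_def using grown_iff[of S class_adj] by blast

lemma linked_connected:
  assumes "linked (cls ` W)" "W \<subseteq> U"
  shows "connected_graph W {e \<in> E. e \<subseteq> W}"
proof -
  let ?S = "cls ` W" and ?R = "{(x, y). {x, y} \<in> {e \<in> E. e \<subseteq> W}}"
  have diff: "(u, v) \<in> ?R\<^sup>*" if uv: "u \<in> W" "v \<in> W" "cls u \<noteq> cls v" for u v
  proof -
    have "\<exists>h. \<forall>i\<in>?S. h i \<in> W \<and> cls (h i) = i" by (rule bchoice) auto
    then obtain h where h: "\<forall>i\<in>?S. h i \<in> W \<and> cls (h i) = i" by (elim exE)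
    \<comment> \<open>The transversal is redirected through \<open>u\<close> and \<open>v\<close>,
      which is possible since they lie in different classes; it still stays inside
      \<open>W\<close>.\<close>
    define g where "g = h(cls u := u, cls v := v)"
    have g: "g i \<in> W \<and> cls (g i) = i" if "i \<in> ?S" for i
      using h uv that by (auto simp: g_def)
    have "(g (cls u), g (cls v)) \<in> {(x, y). {x, y} \<in> E \<and> x \<in> g ` ?S \<and> y \<in> g ` ?S}\<^sup>*"
    proof (rule grown_reach)
      show "g i \<in> U \<and> cls (g i) = i" if "i \<in> ?S" for i using g[OF that] assms(2) by blast
    qed (use assms(1) uv linked_grown in auto)
    moreover have "{(x, y). {x, y} \<in> E \<and> x \<in> g ` ?S \<and> y \<in> g ` ?S} \<subseteq> ?R" using g by auto
    ultimately have "(g (cls u), g (cls v)) \<in> ?R\<^sup>*" using rtrancl_mono by blast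
    then show ?thesis using uv(3) by (simp add: g_def)
  qed
  have "(u, v) \<in> ?R\<^sup>*" if uv: "u \<in> W" "v \<in> W" for u v
  proof (cases "u = v \<or> cls u \<noteq> cls v")
    case False
    show ?thesis
    \<comment> \<open>Two vertices of one class: if that class is all of \<open>?S\<close>,
      linkedness makes it a clique; otherwise the path makes a detour through another class.\<close>
    proof (cases "?S = {cls u}")
      case True
      then have "class_adj (cls u) (cls v)"
        using assms(1) False unfolding linked_def by auto
      then have "{u, v} \<in> E" using edge_iff_class_adj assms(2) uv False by blast
      then show ?thesis using uv by auto
    next
      case neq: False
      then obtain z where z: "z \<in> W" "cls z \<noteq> cls u" using uv by blast
      then have "(u, z) \<in> ?R\<^sup>*" "(z, v) \<in> ?R\<^sup>*"
        using diff[of u z] diff[of z v] uv False by simp_all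
      then show ?thesis by (rule rtrancl_trans)
    qed
  next
    case True
    then show ?thesis using diff[OF uv] by blast
  qed
  moreover have "W \<noteq> {}" using assms(1) by (auto simp: linked_def)
  ultimately show ?thesis unfolding connected_graph_def by blast
qed

theorem graph_motif_iff_accepts:
  assumes "simple_graph V E" "U \<subseteq> V" "2 \<le> size M"
  shows "graph_motif V E col M \<longleftrightarrow> (\<exists>S\<subseteq>{..<K}. S \<noteq> {} \<and> accepts col M S)"
proof
  assume "graph_motif V E col M"
  then obtain W F where WF: "is_subgraph W F V E" "connected_graph W F"
      "image_mset col (mset_set W) = M"
    unfolding graph_motif_def by blast
  have F: "F \<subseteq> E" "\<And>e. e \<in> F \<Longrightarrow> e \<subseteq> W"
    using WF(1) unfolding is_subgraph_def simple_graph_def by auto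
  have cW: "2 \<le> card W" using WF(3) assms(3) by auto
  \<comment> \<open>In a connected subgraph with two or more vertices each vertex has an edge, so no
    isolated vertex of the graph occurs in \<open>W\<close>.\<close>
  have WU: "W \<subseteq> U"
  proof
    fix v assume v: "v \<in> W"
    obtain u where "{v, u} \<in> F"
      using connected_graph_edge[of W F v] WF(2) F(2) cW v by auto
    then show "v \<in> U" using F edge_U by blast
  qed
  have "W \<subseteq> members (cls ` W)" using WU by (auto simp: members_def)
  then have "M \<subseteq># image_mset col (mset_set (members (cls ` W)))"
    unfolding WF(3)[symmetric]
    by (intro image_mset_subseteq_mono subset_imp_msubset_mset_set) auto
  moreover have "cls ` W \<subseteq> {..<K}" "cls ` W \<noteq> {}" using WU cls_less cW by auto
  ultimately show "\<exists>S\<subseteq>{..<K}. S \<noteq> {} \<and> accepts col M S"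
    unfolding accepts_def
    using feasible_necessary[OF WU WF(3)] linked_necessary[OF WF(2) F WU cW] by blast
next
  assume "\<exists>S\<subseteq>{..<K}. S \<noteq> {} \<and> accepts col M S"
  then obtain S where S: "S \<subseteq> {..<K}" "accepts col M S" by blast
  then have "finite S" using finite_subset by blast
  then obtain W where W: "W \<subseteq> U" "cls ` W = S" "image_mset col (mset_set W) = M"
    using feasible_sufficient[of col M S] S unfolding accepts_def by blast
  have "connected_graph W {e \<in> E. e \<subseteq> W}"
    using linked_connected[of W] W S unfolding accepts_def by blast
  moreover have "is_subgraph W {e \<in> E. e \<subseteq> W} V E"
    unfolding is_subgraph_def simple_graph_def
  proof (intro conjI subsetI)
    show "finite W" using W(1) finite_U finite_subset by blast
    fix e assume e: "e \<in> {e \<in> E. e \<subseteq> W}"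
    then obtain u v where "e = {u, v}" "u \<noteq> v" using edge by blast
    then show "e \<in> {{u, v} |u v. u \<in> W \<and> v \<in> W \<and> u \<noteq> v}" using e by blast
  qed (use W(1) assms(2) in auto)
  ultimately show "graph_motif V E col M"
    using W(3) unfolding graph_motif_def by blast
qed

end

section \<open>Weakest preconditions with running time\<close>

text \<open>Total correctness: a halting run must exist. As \<open>runs\<close> is deterministic,
  the postcondition then holds of the only run.\<close>

definition wp :: "com \<Rightarrow> (nat \<Rightarrow> state \<Rightarrow> bool) \<Rightarrow> state \<Rightarrow> bool" where
  "wp c Q s \<longleftrightarrow> (\<exists>t s'. runs c s t s' \<and> Q t s')"

abbreviation upd :: "state \<Rightarrow> vname \<Rightarrow> nat \<Rightarrow> nat \<Rightarrow> state" where
  "upd s x i v \<equiv> s(x := (s x)(i := v))"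

abbreviation Var :: "vname \<Rightarrow> aexp" where
  "Var x \<equiv> Get x (N 0)"

abbreviation Assign :: "vname \<Rightarrow> aexp \<Rightarrow> com" (infix "::=" 61) where
  "x ::= a \<equiv> Put x (N 0) a"

abbreviation Sequence :: "com \<Rightarrow> com \<Rightarrow> com" (infixr ";;" 60) where
  "c ;; d \<equiv> Seq c d"

abbreviation When :: "bexp \<Rightarrow> com \<Rightarrow> com" where
  "When b c \<equiv> IfElse b c Skip"

text \<open>The bound \<open>hi\<close> is evaluated again in every round, so its cost recurs and
  the body has to preserve its value.\<close>

definition For :: "vname \<Rightarrow> aexp \<Rightarrow> aexp \<Rightarrow> com \<Rightarrow> com" where
  "For x lo hi c = (x ::= lo ;; While (Less (Var x) hi) (c ;; x ::= Plus (Var x) (N 1)))"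

lemma wp_mono: "wp c Q s \<Longrightarrow> (\<And>t s'. Q t s' \<Longrightarrow> Q' t s') \<Longrightarrow> wp c Q' s"
  unfolding wp_def by blast

lemma wp_Skip: "wp Skip Q s \<longleftrightarrow> Q 1 s"
proof -
  have "runs Skip s t s' \<longleftrightarrow> t = 1 \<and> s' = s" for t s'
    using runs.Skip[of s] by (auto elim: runs_SkipE)
  then show ?thesis by (simp add: wp_def)
qed

lemma wp_Put: "wp (Put x i a) Q s \<longleftrightarrow> Q (1 + acost i + acost a) (upd s x (aval i s) (aval a s))"
proof -
  have "runs (Put x i a) s t s' \<longleftrightarrow>
      t = 1 + acost i + acost a \<and> s' = upd s x (aval i s) (aval a s)" for t s'
    using runs.Put[of x i a s] by (auto elim: runs_PutE)
  then show ?thesis by (simp add: wp_def)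
qed

lemma wp_Seq: "wp (Seq c d) Q s \<longleftrightarrow> wp c (\<lambda>t s'. wp d (\<lambda>t' s''. Q (1 + t + t') s'') s') s"
proof -
  have "runs (Seq c d) s t s'' \<longleftrightarrow>
      (\<exists>t1 s' t2. runs c s t1 s' \<and> runs d s' t2 s'' \<and> t = 1 + t1 + t2)" for t s''
    using runs.Seq[of c s _ _ d] by (auto elim!: runs_SeqE)
  then show ?thesis unfolding wp_def by (simp only:) metis
qed

lemma wp_IfElse: "wp (IfElse b c d) Q s \<longleftrightarrow>
    (if bval b s then wp c (\<lambda>t s'. Q (1 + bcost b + t) s') s else wp d (\<lambda>t s'. Q (1 + bcost b + t) s') s)"
proof -
  have "runs (IfElse b c d) s t s' \<longleftrightarrow>
      (\<exists>t1. runs (if bval b s then c else d) s t1 s' \<and> t = 1 + bcost b + t1)" for t s'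
    using runs.IfTrue[of b s c _ s' d] runs.IfFalse[of b s d _ s' c]
    by (cases "bval b s") (auto elim!: runs_IfElseE)
  then show ?thesis unfolding wp_def by auto
qed

lemmas wp_simps = wp_Skip wp_Put wp_Seq wp_IfElse

text \<open>Beyond the body a round costs \<open>11 + acost hi\<close>: \<open>4 + acost hi\<close>
  for the test, 6 for the increment and 1 for sequencing. The invariant is demanded after the
  increment, so that it holds for \<open>h\<close> at exit.\<close>

lemma wp_For:
  assumes lo: "aval lo s = l" "l \<le> h"
    and start: "I l (upd s x 0 l)"
    and counter: "\<And>i s. I i s \<Longrightarrow> l \<le> i \<Longrightarrow> i \<le> h \<Longrightarrow> s x 0 = i \<and> aval hi s = h"
    and step: "\<And>i s. I i s \<Longrightarrow> l \<le> i \<Longrightarrow> i < h \<Longrightarrow>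
      wp c (\<lambda>t s'. t \<le> T i \<and> s' x 0 = i \<and> I (Suc i) (upd s' x 0 (Suc i))) s"
    and post: "\<And>t s'. I h s' \<Longrightarrow> t \<le> 8 + acost lo + acost hi + (\<Sum>i=l..<h. T i + 11 + acost hi) \<Longrightarrow> Q t s'"
  shows "wp (For x lo hi c) Q s"
proof -
  let ?w = "While (Less (Var x) hi) (c ;; x ::= Plus (Var x) (N 1))"
  have "\<exists>t s'. runs ?w s t s' \<and> I h s' \<and> t \<le> 4 + acost hi + (\<Sum>j=i..<h. T j + 11 + acost hi)"
    if "i \<le> h" "l \<le> i" "I i s" for i s
    using that
  proof (induction i arbitrary: s rule: inc_induct)
    case base
    then have "\<not> bval (Less (Var x) hi) s" using counter[of h s] by simp
    then have "runs ?w s (1 + bcost (Less (Var x) hi)) s" by (rule runs.WhileFalse)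
    then show ?case using base by (intro exI conjI) auto
  next
    case (step i)
    have b: "bval (Less (Var x) hi) s" using counter[of i s] step by simp
    have "wp c (\<lambda>t s'. t \<le> T i \<and> s' x 0 = i \<and> I (Suc i) (upd s' x 0 (Suc i))) s"
      using assms(5) step by simp
    then obtain t s' where s': "runs c s t s'" "t \<le> T i" "s' x 0 = i"
        "I (Suc i) (upd s' x 0 (Suc i))"
      unfolding wp_def by blast
    have "runs (x ::= Plus (Var x) (N 1)) s' 6 (upd s' x 0 (Suc i))"
      using runs.Put[of x "N 0" "Plus (Var x) (N 1)" s'] s'(3) by (simp add: eval_nat_numeral)
    then have r: "runs (c ;; x ::= Plus (Var x) (N 1)) s (1 + t + 6) (upd s' x 0 (Suc i))"
      by (rule runs.Seq[OF s'(1)])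
    obtain t' s'' where s'': "runs ?w (upd s' x 0 (Suc i)) t' s''" "I h s''"
      "t' \<le> 4 + acost hi + (\<Sum>j=Suc i..<h. T j + 11 + acost hi)"
      using step.IH[OF _ s'(4)] step.prems by (metis le_Suc_eq)
    have "(\<Sum>j=i..<h. T j + 11 + acost hi) =
        (T i + 11 + acost hi) + (\<Sum>j=Suc i..<h. T j + 11 + acost hi)"
      using step.hyps by (simp only: sum.atLeast_Suc_lessThan)
    then have "1 + bcost (Less (Var x) hi) + (1 + t + 6) + t' \<le>
        4 + acost hi + (\<Sum>j=i..<h. T j + 11 + acost hi)"
      using s'(2) s''(3) by simp
    then show ?case using runs.WhileTrue[OF b r s''(1)] s''(2) by blast
  qed
  from this[OF lo(2) _ start] obtain t s' where
    r: "runs ?w (upd s x 0 l) t s'" "I h s'" "t \<le> 4 + acost hi + (\<Sum>j=l..<h. T j + 11 + acost hi)"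
    by auto
  have "runs (x ::= lo) s (2 + acost lo) (upd s x 0 l)"
    using runs.Put[of x "N 0" lo s] lo(1) by simp
  from runs.Seq[OF this r(1)]
  have "runs (For x lo hi c) s (1 + (2 + acost lo) + t) s'" unfolding For_def .
  moreover have "Q (1 + (2 + acost lo) + t) s'" using post r by simp
  ultimately show ?thesis unfolding wp_def by blast
qed

definition eq_off :: "vname set \<Rightarrow> state \<Rightarrow> state \<Rightarrow> bool" where
  "eq_off X s s' \<longleftrightarrow> (\<forall>y. y \<notin> X \<longrightarrow> s' y = s y)"

lemma eq_offD: "eq_off X s s' \<Longrightarrow> y \<notin> X \<Longrightarrow> s' y = s y"
  by (simp add: eq_off_def)

lemma eq_off_refl [simp]: "eq_off X s s"
  by (simp add: eq_off_def)

lemma eq_off_upd: "eq_off X s s' \<Longrightarrow> x \<in> X \<Longrightarrow> eq_off X s (s'(x := f))"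
  by (auto simp: eq_off_def)

lemma eq_off_trans: "eq_off X s s' \<Longrightarrow> eq_off Y s' s'' \<Longrightarrow> X \<union> Y \<subseteq> Z \<Longrightarrow> eq_off Z s s''"
  unfolding eq_off_def by (metis UnCI subsetD)

text \<open>The common form of three loops that evaluate an existential quantifier: a hit sets the
  flag \<open>f\<close> to \<open>r\<close>, and nothing resets it. \<open>P\<close> must describe
  the test in every state that agrees with \<open>s\<close> off \<open>{x, f}\<close>, so that its
  truth depends on the counter alone.\<close>

lemma wp_search:
  assumes "aval lo s = l" "l \<le> h" "x \<noteq> f"
    and hi: "\<And>s'. eq_off {x, f} s s' \<Longrightarrow> aval hi s' = h"
    and P: "\<And>i s'. eq_off {x, f} s s' \<Longrightarrow> s' x 0 = i \<Longrightarrow> l \<le> i \<Longrightarrow> i < h \<Longrightarrow> bval b s' \<longleftrightarrow> P i"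
    and post: "\<And>t s'. eq_off {x, f} s s' \<Longrightarrow>
      s' f 0 = (if \<exists>i\<in>{l..<h}. P i then r else s f 0) \<Longrightarrow>
      t \<le> 8 + acost lo + acost hi + (h - l) * (bcost b + 15 + acost hi) \<Longrightarrow> Q t s'"
  shows "wp (For x lo hi (When b (f ::= N r))) Q s"
proof (rule wp_For[where l = l and h = h and T = "\<lambda>_. 4 + bcost b" and I = "\<lambda>i s'.
    s' x 0 = i \<and> eq_off {x, f} s s' \<and> s' f 0 = (if \<exists>j\<in>{l..<i}. P j then r else s f 0)"])
  fix i s'
  assume I: "s' x 0 = i \<and> eq_off {x, f} s s' \<and> s' f 0 = (if \<exists>j\<in>{l..<i}. P j then r else s f 0)"
    and i: "l \<le> i" "i < h"
  have b: "bval b s' \<longleftrightarrow> P i" using P I i by blast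
  have "{l..<Suc i} = insert i {l..<i}" using i by auto
  then show "wp (When b (f ::= N r)) (\<lambda>t s'. t \<le> 4 + bcost b \<and> s' x 0 = i \<and>
     upd s' x 0 (Suc i) x 0 = Suc i \<and> eq_off {x, f} s (upd s' x 0 (Suc i)) \<and>
     upd s' x 0 (Suc i) f 0 = (if \<exists>j\<in>{l..<Suc i}. P j then r else s f 0)) s'"
    using I b \<open>x \<noteq> f\<close> by (auto simp: wp_simps intro!: eq_off_upd)
qed (use assms in \<open>auto intro: eq_off_upd simp: ac_simps\<close>)

section \<open>The input and its preprocessing\<close>

definition scan_motif :: com where
  "scan_motif = For ''v'' (N 0) (Var ''n'')
     (When (Equal (Get ''col'' (Var ''v'')) (Get ''motif'' (N 0))) (''out'' ::= N 1))"

definition filter_isolated :: com where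
  "filter_isolated = For ''v'' (N 0) (Var ''n'')
     (When (Less (Get ''off'' (Var ''v'')) (Get ''off'' (Plus (Var ''v'') (N 1))))
       (Put ''nz'' (Var ''nn'') (Var ''v'') ;; ''nn'' ::= Plus (Var ''nn'') (N 1)))"

definition count_motif :: com where
  "count_motif = For ''j'' (N 0) (Var ''msize'')
     (Put ''mult'' (Get ''motif'' (Var ''j'')) (Plus (Get ''mult'' (Get ''motif'' (Var ''j''))) (N 1)))"

locale motif_input =
  fixes adj :: "nat list list" and cs ms :: "nat list"
    and V :: "nat set" and E :: "nat set set" and col :: "nat \<Rightarrow> nat" and M :: "nat multiset"
  assumes simple: "simple_graph V E" and enc: "encodes adj cs ms V E col M"
begin

abbreviation n :: nat where "n \<equiv> length adj"

definition deg :: "nat \<Rightarrow> nat" where "deg v = length (adj ! v)"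

definition offs :: "nat \<Rightarrow> nat" where "offs v = sum_list (map length (take v adj))"

definition nonisolated :: "nat list" where "nonisolated = filter (\<lambda>v. 0 < deg v) [0..<n]"

abbreviation nn :: nat where "nn \<equiv> length nonisolated"

definition inputs :: "state \<Rightarrow> bool" where
  "inputs s \<longleftrightarrow> eq_off (- {''n'', ''off'', ''adj'', ''col'', ''msize'', ''motif''}) (input_state adj cs ms) s"

lemma V_eq: "V = {..<n}"
  and adj_distinct: "v < n \<Longrightarrow> distinct (adj ! v)"
  and adj_set: "v < n \<Longrightarrow> set (adj ! v) = neighborhood E v"
  and cs_eq: "cs = map col [0..<n]"
  and ms_eq: "mset ms = M"
  using enc unfolding encodes_def by auto

lemma edge_V: "{u, v} \<in> E \<Longrightarrow> u \<in> V \<and> v \<in> V \<and> u \<noteq> v"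
  using simple unfolding simple_graph_def by (force simp: doubleton_eq_iff)

lemma edge_ends: "e \<in> E \<Longrightarrow> \<exists>u v. e = {u, v} \<and> u \<noteq> v \<and> u \<in> V \<and> v \<in> V"
  using simple unfolding simple_graph_def by blast

lemma neighborhood_V: "w \<in> neighborhood E v \<Longrightarrow> w < n"
  using edge_V V_eq by (auto simp: neighborhood_def)

lemma deg_card: "v < n \<Longrightarrow> deg v = card (neighborhood E v)"
  unfolding deg_def using adj_distinct adj_set distinct_card by metis

lemma offs_Suc: "v < n \<Longrightarrow> offs (Suc v) = offs v + deg v"
  by (simp add: offs_def deg_def take_Suc_conv_app_nth)

lemma offs_mono: "v < n \<Longrightarrow> offs v \<le> offs (Suc v)"
  by (simp add: offs_Suc)

lemma offs_eq_sum: "v \<le> n \<Longrightarrow> offs v = (\<Sum>i<v. deg i)"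
  by (induction v) (simp_all add: offs_Suc, simp add: offs_def)

lemma concat_adj: "v < n \<Longrightarrow> j < deg v \<Longrightarrow>
    offs v + j < length (concat adj) \<and> concat adj ! (offs v + j) = adj ! v ! j"
proof -
  assume "v < n" "j < deg v"
  then have "adj = take v adj @ adj ! v # drop (Suc v) adj" by (simp add: id_take_nth_drop)
  then have c: "concat adj = concat (take v adj) @ adj ! v @ concat (drop (Suc v) adj)"
    by (metis concat.simps(2) concat_append)
  have "length (concat (take v adj)) = offs v" by (simp add: offs_def length_concat)
  then show ?thesis using \<open>j < deg v\<close> unfolding c by (simp add: nth_append deg_def)
qed

lemma inputsD:
  assumes "inputs s"
  shows "s ''n'' 0 = n" "v \<le> n \<Longrightarrow> s ''off'' v = offs v" "v < n \<Longrightarrow> s ''col'' v = col v"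
    "s ''msize'' 0 = size M" "j < size M \<Longrightarrow> s ''motif'' j = ms ! j"
    "v < n \<Longrightarrow> j < deg v \<Longrightarrow> s ''adj'' (offs v + j) = adj ! v ! j"
proof -
  have e: "s y = input_state adj cs ms y"
    if "y \<in> {''n'', ''off'', ''adj'', ''col'', ''msize'', ''motif''}" for y
    using assms that unfolding inputs_def eq_off_def by blast
  have "size M = length ms" using ms_eq by auto
  then show "s ''n'' 0 = n" "v \<le> n \<Longrightarrow> s ''off'' v = offs v" "v < n \<Longrightarrow> s ''col'' v = col v"
    "s ''msize'' 0 = size M" "j < size M \<Longrightarrow> s ''motif'' j = ms ! j"
    "v < n \<Longrightarrow> j < deg v \<Longrightarrow> s ''adj'' (offs v + j) = adj ! v ! j"
    using concat_adj
    by (simp_all add: e input_state_def array_def cs_eq offs_def nth_append del: upt_Suc)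
qed

lemma adj_range:
  assumes "inputs s" "v < n"
  shows "s ''adj'' ` {offs v..<offs (Suc v)} = neighborhood E v"
proof -
  have "{offs v..<offs (Suc v)} = (+) (offs v) ` {..<deg v}"
    using assms(2) by (simp add: offs_Suc lessThan_atLeast0 image_add_atLeastLessThan add.commute)
  then have "s ''adj'' ` {offs v..<offs (Suc v)} = (\<lambda>j. adj ! v ! j) ` {..<deg v}"
    using inputsD(6)[OF assms(1,2)] by (simp add: image_image)
  also have "\<dots> = set (adj ! v)" by (auto simp: deg_def set_conv_nth)
  finally show ?thesis using adj_set assms by simp
qed

lemma bex_adj_range:
  assumes "inputs s" "v < n"
  shows "(\<exists>e\<in>{offs v..<offs (Suc v)}. P (s ''adj'' e)) \<longleftrightarrow> (\<exists>w\<in>neighborhood E v. P w)"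
  unfolding adj_range[OF assms, symmetric] by blast

lemma inputs_eq_off:
  "inputs s \<Longrightarrow> eq_off X s s' \<Longrightarrow> X \<inter> {''n'', ''off'', ''adj'', ''col'', ''msize'', ''motif''} = {} \<Longrightarrow> inputs s'"
  unfolding inputs_def eq_off_def by auto

lemma inputs_upd: "inputs s \<Longrightarrow> x \<notin> {''n'', ''off'', ''adj'', ''col'', ''msize'', ''motif''} \<Longrightarrow>
   inputs (s(x := f))"
  unfolding inputs_def eq_off_def by auto

lemma set_nonisolated: "set nonisolated = {v \<in> V. neighborhood E v \<noteq> {}}"
proof -
  have "0 < deg v \<longleftrightarrow> neighborhood E v \<noteq> {}" if "v < n" for v
    using that adj_set[of v] by (auto simp: deg_def)
  then show ?thesis by (auto simp: nonisolated_def V_eq)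
qed

lemma distinct_nonisolated: "distinct nonisolated"
  by (simp add: nonisolated_def)

lemma nonisolated_less: "v \<in> set nonisolated \<Longrightarrow> v < n"
  by (simp add: nonisolated_def)

lemma edge_nonisolated:
  assumes "{u, v} \<in> E" shows "u \<in> set nonisolated" "v \<in> set nonisolated"
  using edge_V[OF assms] assms unfolding set_nonisolated by (auto simp: neighborhood_def insert_commute)

text \<open>Each nonisolated vertex has at least one entry in its adjacency list. So a loop over
  these vertices, repeated for every set of classes, stays within \<open>O(|E|)\<close>.\<close>

lemma nn_le: "nn \<le> offs n"
proof -
  have "nn = (\<Sum>v\<in>set nonisolated. 1)" using distinct_nonisolated distinct_card by fastforce
  also have "\<dots> \<le> (\<Sum>v\<in>set nonisolated. deg v)"
    by (intro sum_mono) (auto simp: nonisolated_def)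
  also have "\<dots> \<le> (\<Sum>v<n. deg v)"
    by (intro sum_mono2) (auto simp: nonisolated_def)
  finally show ?thesis by (simp add: offs_eq_sum)
qed

lemma offs_le_edges: "offs n \<le> 2 * card E"
proof -
  have finE: "finite E"
  proof (rule finite_subset)
    show "E \<subseteq> Pow V" using edge_ends by blast
  qed (simp add: V_eq)
  \<comment> \<open>An ordered pair of adjacent vertices is determined by its edge and by which end
    comes first; hence the factor 2.\<close>
  let ?f = "\<lambda>(u, v). ({u, v}, u < v)"
  have "offs n = (\<Sum>v<n. card (neighborhood E v))"
    by (simp add: offs_eq_sum deg_card)
  also have "\<dots> = card (SIGMA v:{..<n}. neighborhood E v)"
    by (subst card_SigmaI) (auto intro: finite_subset[of _ "{..<n}"] dest: neighborhood_V)
  also have "\<dots> \<le> card (E \<times> (UNIV :: bool set))"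
  proof (rule card_inj_on_le[of ?f])
    show "inj_on ?f (SIGMA v:{..<n}. neighborhood E v)"
      by (rule inj_onI) (auto simp: neighborhood_def doubleton_eq_iff dest: edge_V)
    show "?f ` (SIGMA v:{..<n}. neighborhood E v) \<subseteq> E \<times> UNIV"
      by (auto simp: neighborhood_def insert_commute)
  qed (use finE in simp)
  finally show ?thesis using finE by (simp add: card_cartesian_product)
qed

section \<open>Correctness and cost of the preprocessing loops\<close>

lemma wp_scan_motif:
  assumes "inputs s" "size M = 1" "s ''out'' 0 = 0"
  shows "wp scan_motif (\<lambda>t s'. t \<le> 40 * (n + 1) \<and>
    s' ''out'' 0 = (if \<exists>v\<in>V. M = {#col v#} then 1 else 0)) s"
  unfolding scan_motif_def
proof (rule wp_search[where P = "\<lambda>v. M = {#col v#}" and l = 0 and h = n])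
  fix i s' assume s': "eq_off {''v'', ''out''} s s'" "s' ''v'' 0 = i" "i < n"
  then have inp: "inputs s'" using inputs_eq_off[OF assms(1)] by simp
  obtain c where "ms = [c]" "M = {#c#}"
    using ms_eq assms(2) by (metis One_nat_def length_0_conv length_Suc_conv mset.simps size_mset)
  then show "bval (Equal (Get ''col'' (Var ''v'')) (Get ''motif'' (N 0))) s' \<longleftrightarrow> M = {#col i#}"
    using inputsD[OF inp] s' assms by auto
next
  fix s' assume "eq_off {''v'', ''out''} s s'"
  then have inp: "inputs s'" using inputs_eq_off[OF assms(1)] by simp
  then show "aval (Var ''n'') s' = n" using inputsD by simp
qed (use assms in \<open>auto simp: V_eq\<close>)

definition nonisolated_state :: "state \<Rightarrow> bool" where
  "nonisolated_state s \<longleftrightarrow> s ''nn'' 0 = nn \<and> (\<forall>a<nn. s ''nz'' a = nonisolated ! a)"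

lemma wp_filter_isolated:
  assumes "inputs s" "s ''nn'' 0 = 0"
  shows "wp filter_isolated (\<lambda>t s'. t \<le> 40 * (n + 1) \<and>
    nonisolated_state s' \<and> eq_off {''v'', ''nn'', ''nz''} s s') s"
  unfolding filter_isolated_def
proof (rule wp_For[where l = 0 and h = n and T = "\<lambda>_. 25" and I = "\<lambda>i s'. s' ''v'' 0 = i \<and>
    eq_off {''v'', ''nn'', ''nz''} s s' \<and>
    (let L = filter (\<lambda>v. 0 < deg v) [0..<i] in s' ''nn'' 0 = length L \<and> (\<forall>a<length L. s' ''nz'' a = L ! a))"],
    goal_cases)
  case (4 i s')
  then have inp: "inputs s'" using inputs_eq_off[OF assms(1), of "{''v'', ''nn'', ''nz''}" s'] by simp
  then show ?case using 4 inputsD(1) by simp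
next
  case (5 i s')
  then have inp: "inputs s'" using inputs_eq_off[OF assms(1), of "{''v'', ''nn'', ''nz''}" s'] by simp
  have *: "bval (Less (Get ''off'' (Var ''v'')) (Get ''off'' (Plus (Var ''v'') (N 1)))) s' \<longleftrightarrow> 0 < deg i"
    using 5 inputsD[OF inp] by (simp add: offs_Suc)
  show ?case
    using 5 * by (auto simp: wp_simps Let_def nth_append less_Suc_eq intro!: eq_off_upd)
qed (use assms in \<open>auto simp: nonisolated_state_def nonisolated_def Let_def intro: eq_off_upd\<close>)

lemma wp_count_motif:
  assumes "inputs s" "\<And>c. s ''mult'' c = 0"
  shows "wp count_motif (\<lambda>t s'. t \<le> 30 * (size M + 1) \<and>
    (\<forall>c. s' ''mult'' c = count M c) \<and> eq_off {''j'', ''mult''} s s') s"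
  unfolding count_motif_def
proof (rule wp_For[where l = 0 and h = "size M" and T = "\<lambda>_. 12" and I = "\<lambda>i s'. s' ''j'' 0 = i \<and>
    eq_off {''j'', ''mult''} s s' \<and> (\<forall>c. s' ''mult'' c = count (mset (take i ms)) c)"], goal_cases)
  case (4 i s')
  then have inp: "inputs s'" using inputs_eq_off[OF assms(1), of "{''j'', ''mult''}" s'] by simp
  then show ?case using 4 inputsD by simp
next
  case (5 i s')
  then have inp: "inputs s'" using inputs_eq_off[OF assms(1), of "{''j'', ''mult''}" s'] by simp
  have "i < length ms" using 5 ms_eq by auto
  then show ?case
    using 5 inputsD(5)[OF inp] by (auto simp: wp_simps take_Suc_conv_app_nth intro!: eq_off_upd)
next
  case (6 t s')
  then show ?case using ms_eq by auto
qed (use assms in \<open>auto intro: eq_off_upd\<close>)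

end

section \<open>Computing the twin classes\<close>

text \<open>The value \<open>v + 1\<close> serves as a time stamp, so marks never have to be erased.\<close>

definition mark_neighbors :: com where
  "mark_neighbors = For ''e'' (Get ''off'' (Var ''v'')) (Get ''off'' (Plus (Var ''v'') (N 1)))
     (Put ''mark'' (Get ''adj'' (Var ''e'')) (Plus (Var ''v'') (N 1)))"

text \<open>
  Vertices of the same type have the same degree. Comparing degrees first bounds the cost by the
  degree of \<open>v\<close> instead of that of the representative, and leaves only one inclusion to check.
\<close>

definition compare_types :: com where
  "compare_types =
     (''u'' ::= Get ''rep'' (Var ''i'') ;;
      When (Equal (Minus (Get ''off'' (Plus (Var ''u'') (N 1))) (Get ''off'' (Var ''u'')))
                  (Minus (Get ''off'' (Plus (Var ''v'') (N 1))) (Get ''off'' (Var ''v''))))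
        (''ok'' ::= N 1 ;;
         For ''e'' (Get ''off'' (Var ''u'')) (Get ''off'' (Plus (Var ''u'') (N 1)))
           (When (Conj (Neg (Equal (Get ''adj'' (Var ''e'')) (Var ''v'')))
                       (Neg (Equal (Get ''mark'' (Get ''adj'' (Var ''e''))) (Plus (Var ''v'') (N 1)))))
             (''ok'' ::= N 0)) ;;
         When (Equal (Var ''ok'') (N 1)) (Put ''cls'' (Var ''v'') (Var ''i''))))"

text \<open>\<open>cls[v]\<close> starts at \<open>nk\<close>, the index of the class that would be
  opened next. If no representative matches, this value is already right, and the final test
  recognizes the new class by it.\<close>

definition classify_vertex :: com where
  "classify_vertex =
     (''v'' ::= Get ''nz'' (Var ''a'') ;;
      mark_neighbors ;;
      Put ''cls'' (Var ''v'') (Var ''nk'') ;;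
      For ''i'' (N 0) (Var ''nk'') compare_types ;;
      When (Equal (Get ''cls'' (Var ''v'')) (Var ''nk''))
        (Put ''rep'' (Var ''nk'') (Var ''v'') ;; ''nk'' ::= Plus (Var ''nk'') (N 1)))"

definition classify :: com where
  "classify = For ''a'' (N 0) (Var ''nn'') classify_vertex"

context motif_input
begin

lemma finite_neighborhood: "finite (neighborhood E v)"
  by (rule finite_subset[of _ "{..<n}"]) (auto dest: neighborhood_V)

text \<open>Adjacency of \<open>u\<close> and \<open>v\<close> removes one vertex from both
  neighborhoods or from neither. So equal degrees mean that the two sets compared by
  \<open>same_type\<close> have equal size, and one inclusion makes them equal.\<close>

lemma same_type_iff:
  assumes "u < n" "v < n"
  shows "same_type E u v \<longleftrightarrow>
    deg u = deg v \<and> \<not> (\<exists>w\<in>neighborhood E u. w \<noteq> v \<and> w \<notin> neighborhood E v)"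
proof -
  let ?A = "neighborhood E u" and ?B = "neighborhood E v"
  have vu: "v \<in> ?A \<longleftrightarrow> u \<in> ?B" by (rule neighborhood_sym)
  have cA: "card (?A - {v}) = (if v \<in> ?A then deg u - 1 else deg u)"
    and cB: "card (?B - {u}) = (if v \<in> ?A then deg v - 1 else deg v)"
    using assms finite_neighborhood vu by (auto simp: deg_card)
  \<comment> \<open>Adjacent vertices have positive degree, so the truncated subtraction of 1 loses
    nothing.\<close>
  have pos: "v \<in> ?A \<Longrightarrow> 0 < deg u \<and> 0 < deg v"
    using assms finite_neighborhood vu by (auto simp: deg_card card_gt_0_iff)
  have eq: "deg u = deg v \<longleftrightarrow> card (?A - {v}) = card (?B - {u})"
    using cA cB pos by (cases "v \<in> ?A") auto
  have irr: "u \<notin> ?A" using edge_V[of u u] by (auto simp: neighborhood_def)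
  show ?thesis
  proof
    assume "same_type E u v"
    then show "deg u = deg v \<and> \<not> (\<exists>w\<in>?A. w \<noteq> v \<and> w \<notin> ?B)"
      unfolding eq same_type_def by auto
  next
    assume R: "deg u = deg v \<and> \<not> (\<exists>w\<in>?A. w \<noteq> v \<and> w \<notin> ?B)"
    then have "?A - {v} \<subseteq> ?B - {u}" using irr by blast
    moreover have "card (?A - {v}) = card (?B - {u})" using R eq by blast
    ultimately show "same_type E u v"
      unfolding same_type_def using finite_neighborhood by (intro card_subset_eq) auto
  qed
qed

lemma wp_mark_neighbors:
  assumes "inputs s" "s ''v'' 0 = v" "v < n"
  shows "wp mark_neighbors (\<lambda>t s'. t \<le> 40 * (deg v + 1) \<and> eq_off {''e'', ''mark''} s s' \<and>
    (\<forall>w. s' ''mark'' w = (if w \<in> neighborhood E v then Suc v else s ''mark'' w))) s"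
  unfolding mark_neighbors_def
proof (rule wp_For[where l = "offs v" and h = "offs (Suc v)" and T = "\<lambda>_. 10" and I = "\<lambda>i s'.
    s' ''e'' 0 = i \<and> eq_off {''e'', ''mark''} s s' \<and>
    (\<forall>w. s' ''mark'' w = (if w \<in> s ''adj'' ` {offs v..<i} then Suc v else s ''mark'' w))"], goal_cases)
  case 2
  then show ?case using offs_mono assms by simp
next
  case (4 i s')
  then have "inputs s'" using inputs_eq_off[OF assms(1), of "{''e'', ''mark''}" s'] by simp
  then show ?case using 4 inputsD assms eq_offD[of "{''e'', ''mark''}" s s'] by simp
next
  case (5 i s')
  then have fr: "eq_off {''e'', ''mark''} s s'" by simp
  have "{offs v..<Suc i} = insert i {offs v..<i}" using 5 by auto
  then show ?case using 5 assms eq_offD[OF fr] by (auto simp: wp_simps intro!: eq_off_upd)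
next
  case (6 t s')
  then show ?case
    using assms adj_range[OF assms(1,3)] by (simp add: offs_Suc algebra_simps)
qed (use inputsD[OF assms(1)] assms in \<open>auto intro: eq_off_upd\<close>)

lemma wp_compare_types:
  assumes "inputs s" "s ''v'' 0 = v" "v < n" "s ''i'' 0 = i" "s ''rep'' i = u" "u < n"
    and mark: "\<And>w. s ''mark'' w = Suc v \<longleftrightarrow> w \<in> neighborhood E v"
  shows "wp compare_types (\<lambda>t s'. t \<le> 100 * (deg v + 1) \<and> eq_off {''u'', ''ok'', ''e'', ''cls''} s s' \<and>
    s' ''cls'' = (if same_type E u v then (s ''cls'')(v := i) else s ''cls'')) s"
proof (cases "deg u = deg v")
  case False
  then show ?thesis
    using assms inputsD(2)[OF assms(1)] same_type_iff[of u v]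
    by (auto simp: compare_types_def wp_simps offs_Suc intro!: eq_off_upd)
next
  case True
  let ?b = "Conj (Neg (Equal (Get ''adj'' (Var ''e'')) (Var ''v'')))
                 (Neg (Equal (Get ''mark'' (Get ''adj'' (Var ''e''))) (Plus (Var ''v'') (N 1))))"
  let ?s = "upd (upd s ''u'' 0 u) ''ok'' 0 1"
  have inp: "inputs ?s" by (intro inputs_upd assms) auto
  have loop: "wp (For ''e'' (Get ''off'' (Var ''u'')) (Get ''off'' (Plus (Var ''u'') (N 1)))
      (When ?b (''ok'' ::= N 0))) (\<lambda>t s'. t \<le> 20 + deg v * 40 \<and> eq_off {''e'', ''ok''} ?s s' \<and>
        s' ''ok'' 0 = (if same_type E u v then 1 else 0)) ?s"
  proof (rule wp_search[where l = "offs u" and h = "offs (Suc u)" and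
      P = "\<lambda>e. s ''adj'' e \<noteq> v \<and> s ''adj'' e \<notin> neighborhood E v"], goal_cases)
    case (4 s')
    then have "inputs s'" using inputs_eq_off[OF inp, of "{''e'', ''ok''}" s'] by simp
    then show ?case using 4 inputsD assms eq_offD[of "{''e'', ''ok''}" ?s s'] by simp
  next
    case (5 i s')
    then show ?case using mark assms eq_offD[of "{''e'', ''ok''}" ?s s'] by simp
  next
    case (6 t s')
    have "same_type E u v \<longleftrightarrow>
        \<not> (\<exists>e\<in>{offs u..<offs (Suc u)}. s ''adj'' e \<noteq> v \<and> s ''adj'' e \<notin> neighborhood E v)"
      using bex_adj_range[OF assms(1), of u "\<lambda>w. w \<noteq> v \<and> w \<notin> neighborhood E v"]
        same_type_iff[of u v] assms True by simp
    then show ?case using 6 True assms by (simp add: offs_Suc)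
  qed (use assms offs_mono inputsD(2)[OF inp] in auto)
  have pre: "bval (Equal (Minus (Get ''off'' (Plus (Var ''u'') (N 1))) (Get ''off'' (Var ''u'')))
      (Minus (Get ''off'' (Plus (Var ''v'') (N 1))) (Get ''off'' (Var ''v'')))) (upd s ''u'' 0 u)"
    using assms True inputsD(2)[OF assms(1)] by (simp add: offs_Suc)
  have e: "upd s ''u'' (aval (N 0) s) (aval (Get ''rep'' (Var ''i'')) s) = upd s ''u'' 0 u"
      "upd (upd s ''u'' 0 u) ''ok'' (aval (N 0) (upd s ''u'' 0 u)) (aval (N 1) (upd s ''u'' 0 u)) = ?s"
    using assms by simp_all
  show ?thesis
    unfolding compare_types_def wp_Seq wp_Put wp_IfElse e if_P[OF pre]
  proof (rule wp_mono[OF loop], goal_cases)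
    case (1 t s')
    then have fr: "eq_off {''e'', ''ok''} ?s s'" by simp
    have fr': "eq_off {''u'', ''ok'', ''e'', ''cls''} s s'"
      using fr by (auto simp: eq_off_def)
    show ?case
      using 1 eq_offD[OF fr] assms by (auto simp: wp_Skip intro!: eq_off_upd[OF fr'] fr')
  qed
qed

text \<open>\<open>L\<close> is the set of vertices treated so far. The last conjunct keeps the
  types of the representatives pairwise different, which limits their number.\<close>

definition classified :: "nat set \<Rightarrow> state \<Rightarrow> bool" where
  "classified L s \<longleftrightarrow>
     (\<forall>i<s ''nk'' 0. s ''rep'' i \<in> L \<and> s ''cls'' (s ''rep'' i) = i) \<and>
     (\<forall>v\<in>L. s ''cls'' v < s ''nk'' 0 \<and> same_type E (s ''rep'' (s ''cls'' v)) v) \<and>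
     (\<forall>i<s ''nk'' 0. \<forall>j<i. \<not> same_type E (s ''rep'' j) (s ''rep'' i))"

text \<open>Two representatives in one block of the partition would have the same type. Allowing
  every \<open>L \<subseteq> V\<close> bounds the number of classes already in the middle of the
  loop, as its running time requires.\<close>

lemma classified_le:
  assumes "classified L s" "L \<subseteq> V" "neighborhood_diversity_at_most V E k"
  shows "s ''nk'' 0 \<le> k"
proof -
  obtain P where P: "partition_on V P" "card P \<le> k" "\<forall>S\<in>P. \<forall>u\<in>S. \<forall>v\<in>S. same_type E u v"
    using assms(3) unfolding neighborhood_diversity_at_most_def by blast
  have "\<forall>i\<in>{..<s ''nk'' 0}. \<exists>S\<in>P. s ''rep'' i \<in> S"
  proof
    fix i assume "i \<in> {..<s ''nk'' 0}"
    then have "s ''rep'' i \<in> V" using assms(1,2) unfolding classified_def by blast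
    then show "\<exists>S\<in>P. s ''rep'' i \<in> S" using P(1) unfolding partition_on_def by blast
  qed
  then have "\<exists>f. \<forall>i\<in>{..<s ''nk'' 0}. f i \<in> P \<and> s ''rep'' i \<in> f i" by (intro bchoice) blast
  then obtain f where f: "\<forall>i\<in>{..<s ''nk'' 0}. f i \<in> P \<and> s ''rep'' i \<in> f i" by (elim exE)
  have "inj_on f {..<s ''nk'' 0}"
  proof (rule linorder_inj_onI')
    fix j i assume ij: "j \<in> {..<s ''nk'' 0}" "i \<in> {..<s ''nk'' 0}" "j < i"
    show "f j \<noteq> f i"
    proof
      assume "f j = f i"
      then have "same_type E (s ''rep'' j) (s ''rep'' i)" using f P(3) ij by metis
      then show False using assms(1) ij unfolding classified_def by blast
    qed
  qed
  moreover have "finite P" using P(1) finite_elements[of V P] V_eq by simp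
  ultimately have "card {..<s ''nk'' 0} \<le> card P"
    using f by (intro card_inj_on_le) auto
  then show ?thesis using P(2) by simp
qed

lemma wp_classify_vertex:
  assumes inp: "inputs s" and nz: "nonisolated_state s" and a: "s ''a'' 0 = a" "a < nn"
    and cl: "classified (set (take a nonisolated)) s"
    and mark: "\<And>w v. v \<notin> set (take a nonisolated) \<Longrightarrow> s ''mark'' w \<noteq> Suc v"
  shows "wp classify_vertex (\<lambda>t s'. t \<le> 200 * ((s ''nk'' 0 + 1) * (deg (nonisolated ! a) + 1)) \<and>
    eq_off {''v'', ''e'', ''mark'', ''cls'', ''i'', ''u'', ''ok'', ''rep'', ''nk''} s s' \<and>
    classified (set (take (Suc a) nonisolated)) s' \<and>
    (\<forall>w. \<forall>v. v \<notin> set (take (Suc a) nonisolated) \<longrightarrow> s' ''mark'' w \<noteq> Suc v)) s"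
proof -
  define v where "v = nonisolated ! a"
  define K where "K = s ''nk'' 0"
  let ?L = "set (take a nonisolated)"
  have L': "set (take (Suc a) nonisolated) = insert v ?L"
    using a by (simp add: take_Suc_conv_app_nth v_def)
  have vL: "v \<notin> ?L"
    using distinct_nonisolated a unfolding v_def
    by (auto simp: in_set_conv_nth nth_eq_iff_index_eq)
  have "v \<in> set nonisolated" using a by (simp add: v_def)
  then have v: "v < n" by (rule nonisolated_less)
  have L: "u < n" if "u \<in> ?L" for u
    using that in_set_takeD nonisolated_less by metis
  let ?s1 = "upd s ''v'' 0 v"
  have e1: "upd s ''v'' (aval (N 0) s) (aval (Get ''nz'' (Var ''a'')) s) = ?s1"
    using nz a by (simp add: nonisolated_state_def v_def)
  have mk: "wp mark_neighbors (\<lambda>t s'. t \<le> 40 * (deg v + 1) \<and> eq_off {''e'', ''mark''} ?s1 s' \<and>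
      (\<forall>w. s' ''mark'' w = (if w \<in> neighborhood E v then Suc v else ?s1 ''mark'' w))) ?s1"
    by (rule wp_mark_neighbors) (use v inp in \<open>auto intro: inputs_upd\<close>)
  \<comment> \<open>The entry \<open>c\<close> for \<open>v\<close> is either the default
    \<open>K\<close>, with no match so far, or the index of a matching representative; a later match
    would merely overwrite it.\<close>
  have loop: "wp (For ''i'' (N 0) (Var ''nk'') compare_types)
      (\<lambda>t s'. t \<le> 120 * ((K + 1) * (deg v + 1)) \<and>
        eq_off {''i'', ''u'', ''ok'', ''e'', ''cls''} s2 s' \<and>
        (\<exists>c. s' ''cls'' = (s2 ''cls'')(v := c) \<and>
          (c = K \<and> (\<forall>j<K. \<not> same_type E (s ''rep'' j) v) \<or> c < K \<and> same_type E (s ''rep'' c) v))) s2"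
    if inp2: "inputs s2" and s2: "s2 ''v'' 0 = v" "s2 ''nk'' 0 = K" "s2 ''rep'' = s ''rep''"
      "s2 ''cls'' v = K" and mark2: "\<And>w. s2 ''mark'' w = Suc v \<longleftrightarrow> w \<in> neighborhood E v" for s2
  proof (rule wp_For[where l = 0 and h = K and T = "\<lambda>_. 100 * (deg v + 1)" and I = "\<lambda>i s'. s' ''i'' 0 = i \<and>
        eq_off {''i'', ''u'', ''ok'', ''e'', ''cls''} s2 s' \<and>
        (\<exists>c. s' ''cls'' = (s2 ''cls'')(v := c) \<and>
          (c = K \<and> (\<forall>j<i. \<not> same_type E (s ''rep'' j) v) \<or> c < K \<and> same_type E (s ''rep'' c) v))"],
      goal_cases)
    case 3
    then show ?case using s2 by (auto intro!: eq_off_upd exI[of _ K])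
  next
    case (4 i s')
    then have fr: "eq_off {''i'', ''u'', ''ok'', ''e'', ''cls''} s2 s'" by blast
    show ?case using 4 s2 eq_offD[OF fr] by simp
  next
    case (5 i s')
    then have fr: "eq_off {''i'', ''u'', ''ok'', ''e'', ''cls''} s2 s'" by blast
    obtain c where c: "s' ''cls'' = (s2 ''cls'')(v := c)"
        "c = K \<and> (\<forall>j<i. \<not> same_type E (s ''rep'' j) v) \<or> c < K \<and> same_type E (s ''rep'' c) v"
      using 5 by blast
    have inp': "inputs s'" using inputs_eq_off[OF inp2 fr] by simp
    have u: "s ''rep'' i < n" using cl 5 L unfolding classified_def K_def by blast
    have "wp compare_types (\<lambda>t s''. t \<le> 100 * (deg v + 1) \<and> eq_off {''u'', ''ok'', ''e'', ''cls''} s' s'' \<and>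
      s'' ''cls'' = (if same_type E (s ''rep'' i) v then (s' ''cls'')(v := i) else s' ''cls'')) s'"
      by (rule wp_compare_types) (use inp' v u 5 s2 mark2 eq_offD[OF fr] in auto)
    then show ?case
    proof (rule wp_mono, goal_cases)
      case (1 t s'')
      then have fr': "eq_off {''u'', ''ok'', ''e'', ''cls''} s' s''" by blast
      have "eq_off {''i'', ''u'', ''ok'', ''e'', ''cls''} s2 s''"
        by (rule eq_off_trans[OF fr fr']) auto
      moreover have "s'' ''i'' 0 = i" using 5 eq_offD[OF fr'] by simp
      moreover have "\<exists>c. s'' ''cls'' = (s2 ''cls'')(v := c) \<and>
          (c = K \<and> (\<forall>j<Suc i. \<not> same_type E (s ''rep'' j) v) \<or> c < K \<and> same_type E (s ''rep'' c) v)"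
      proof (cases "same_type E (s ''rep'' i) v")
        case True
        then show ?thesis using 1 5 c by (intro exI[of _ i]) auto
      next
        case False
        then show ?thesis using 1 c by (intro exI[of _ c]) (auto simp: less_Suc_eq)
      qed
      ultimately show ?case using 1 by (auto intro: eq_off_upd)
    qed
  next
    case (6 t s')
    then show ?case by (auto simp: algebra_simps)
  qed auto
  show ?thesis
    unfolding classify_vertex_def wp_Seq wp_Put e1
  proof (rule wp_mono[OF mk], goal_cases)
    case (1 t s1')
    then have fr1: "eq_off {''e'', ''mark''} ?s1 s1'" by blast
    let ?s2 = "upd s1' ''cls'' v K"
    have e2: "upd s1' ''cls'' (aval (Var ''v'') s1') (aval (Var ''nk'') s1') = ?s2"
      using eq_offD[OF fr1] by (simp add: K_def)
    have "inputs ?s1" using inp by (rule inputs_upd) simp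
    then have "inputs s1'" by (rule inputs_eq_off[OF _ fr1]) simp
    then have inp2: "inputs ?s2" by (rule inputs_upd) simp
    have mark2: "?s2 ''mark'' w = Suc v \<longleftrightarrow> w \<in> neighborhood E v" for w
      using 1 mark[OF vL] by simp
    have s2: "?s2 ''v'' 0 = v" "?s2 ''nk'' 0 = K" "?s2 ''rep'' = s ''rep''" "?s2 ''cls'' v = K"
      using eq_offD[OF fr1] by (simp_all add: K_def)
    show ?case
      unfolding e2
    proof (rule wp_mono[OF loop[OF inp2 s2 mark2]], goal_cases)
      case (1 t' s3)
      then have fr2: "eq_off {''i'', ''u'', ''ok'', ''e'', ''cls''} ?s2 s3" by blast
      obtain c where c: "s3 ''cls'' = (?s2 ''cls'')(v := c)"
        "c = K \<and> (\<forall>j<K. \<not> same_type E (s ''rep'' j) v) \<or> c < K \<and> same_type E (s ''rep'' c) v"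
        using 1 by blast
      let ?X = "{''v'', ''e'', ''mark'', ''cls'', ''i'', ''u'', ''ok'', ''rep'', ''nk''}"
      have fr: "eq_off ?X s s3"
        using fr1 fr2 unfolding eq_off_def by simp
      have s3: "s3 ''v'' 0 = v" "s3 ''nk'' 0 = K" "s3 ''rep'' = s ''rep''"
          "s3 ''cls'' = (s ''cls'')(v := c)" "s3 ''mark'' = s1' ''mark''"
        using eq_offD[OF fr2] eq_offD[OF fr1] s2 c by (simp_all add: fun_eq_iff)
      have mk': "\<forall>w. \<forall>u. u \<notin> insert v ?L \<longrightarrow> s3 ''mark'' w \<noteq> Suc u"
        using \<open>t \<le> 40 * (deg v + 1) \<and> _\<close> mark unfolding s3 by simp
      have cl': "(\<forall>i<K. s ''rep'' i \<in> ?L \<and> s ''cls'' (s ''rep'' i) = i)"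
         "(\<forall>v\<in>?L. s ''cls'' v < K \<and> same_type E (s ''rep'' (s ''cls'' v)) v)"
         "(\<forall>i<K. \<forall>j<i. \<not> same_type E (s ''rep'' j) (s ''rep'' i))"
        using cl unfolding classified_def K_def by blast+
      have time: "t' + t \<le> 160 * ((K + 1) * (deg v + 1))"
        using 1 \<open>t \<le> 40 * (deg v + 1) \<and> _\<close> by (auto simp: algebra_simps)
      have one: "1 \<le> (K + 1) * (deg v + 1)" by simp
      show ?case
      proof (cases "c = K")
        case True
        let ?s4 = "upd (upd s3 ''rep'' K v) ''nk'' 0 (Suc K)"
        have "classified (insert v ?L) ?s4"
          unfolding classified_def
        proof (intro conjI, goal_cases)
          case 1
          then show ?case using cl' s3 vL True by (auto simp: less_Suc_eq)
        next
          case 2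
          have "rep \<noteq> K" if "rep < K" for rep using that by simp
          then show ?case using cl' s3 vL True by fastforce
        next
          case 3
          then show ?case using cl' s3 vL True c by (auto simp: less_Suc_eq)
        qed
        moreover have "eq_off ?X s ?s4" by (intro eq_off_upd fr) auto
        ultimately show ?thesis
          using True s3 mk' time one unfolding L' K_def[symmetric] v_def[symmetric]
          by (simp add: wp_simps)
      next
        case False
        then have "c < K" "same_type E (s ''rep'' c) v" using c by auto
        then have "classified (insert v ?L) s3"
          using cl' s3 vL unfolding classified_def by auto
        then show ?thesis
          using False s3 mk' time one fr unfolding L' K_def[symmetric] v_def[symmetric]
          by (simp add: wp_simps)
      qed
    qed
  qed
qed

lemma wp_classify:
  assumes inp: "inputs s" and nz: "nonisolated_state s"
    and init: "s ''nk'' 0 = 0" "\<And>w. s ''mark'' w = 0"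
    and k: "neighborhood_diversity_at_most V E k"
  shows "wp classify (\<lambda>t s'. t \<le> 500 * ((k + 1) * (offs n + 1)) \<and>
    eq_off {''a'', ''v'', ''e'', ''mark'', ''cls'', ''i'', ''u'', ''ok'', ''rep'', ''nk''} s s' \<and>
    classified (set nonisolated) s') s"
  unfolding classify_def
proof (rule wp_For[where l = 0 and h = nn and
    T = "\<lambda>a. 200 * ((k + 1) * (deg (nonisolated ! a) + 1))" and I = "\<lambda>a s'. s' ''a'' 0 = a \<and>
    eq_off {''a'', ''v'', ''e'', ''mark'', ''cls'', ''i'', ''u'', ''ok'', ''rep'', ''nk''} s s' \<and>
    classified (set (take a nonisolated)) s' \<and>
    (\<forall>w. \<forall>v. v \<notin> set (take a nonisolated) \<longrightarrow> s' ''mark'' w \<noteq> Suc v)"], goal_cases)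
  case 3
  then show ?case using init by (auto simp: classified_def intro: eq_off_upd)
next
  case (4 i s')
  then have fr: "eq_off {''a'', ''v'', ''e'', ''mark'', ''cls'', ''i'', ''u'', ''ok'', ''rep'', ''nk''} s s'"
    by blast
  show ?case using 4 eq_offD[OF fr] nz by (simp add: nonisolated_state_def)
next
  case (5 a s')
  let ?X = "{''a'', ''v'', ''e'', ''mark'', ''cls'', ''i'', ''u'', ''ok'', ''rep'', ''nk''}"
  have fr: "eq_off ?X s s'" using 5 by blast
  have inp': "inputs s'" by (rule inputs_eq_off[OF inp fr]) simp
  have nz': "nonisolated_state s'" using nz eq_offD[OF fr] by (simp add: nonisolated_state_def)
  have cl: "classified (set (take a nonisolated)) s'" using 5 by blast
  have "set (take a nonisolated) \<subseteq> V"
    using set_take_subset[of a nonisolated] set_nonisolated by blast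
  then have nk: "s' ''nk'' 0 \<le> k" using classified_le[OF cl _ k] by blast
  have "wp classify_vertex (\<lambda>t s''. t \<le> 200 * ((s' ''nk'' 0 + 1) * (deg (nonisolated ! a) + 1)) \<and>
    eq_off {''v'', ''e'', ''mark'', ''cls'', ''i'', ''u'', ''ok'', ''rep'', ''nk''} s' s'' \<and>
    classified (set (take (Suc a) nonisolated)) s'' \<and>
    (\<forall>w. \<forall>v. v \<notin> set (take (Suc a) nonisolated) \<longrightarrow> s'' ''mark'' w \<noteq> Suc v)) s'"
    by (rule wp_classify_vertex) (use inp' nz' cl 5 in auto)
  then show ?case
  proof (rule wp_mono, goal_cases)
    case (1 t s'')
    then have fr': "eq_off {''v'', ''e'', ''mark'', ''cls'', ''i'', ''u'', ''ok'', ''rep'', ''nk''} s' s''"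
      by blast
    have "eq_off ?X s s''" by (rule eq_off_trans[OF fr fr']) auto
    moreover have "s'' ''a'' 0 = a" using eq_offD[OF fr'] 5 by simp
    moreover have "t \<le> 200 * ((k + 1) * (deg (nonisolated ! a) + 1))"
    proof -
      have "(s' ''nk'' 0 + 1) * (deg (nonisolated ! a) + 1) \<le> (k + 1) * (deg (nonisolated ! a) + 1)"
        using nk by (intro mult_right_mono) auto
      then show ?thesis using 1 by linarith
    qed
    ultimately show ?case using 1 by (auto simp: classified_def intro!: eq_off_upd)
  qed
next
  case (6 t s')
  \<comment> \<open>Up to a constant a round costs \<open>k + 1\<close> times the degree plus one;
    over all rounds the degrees and the ones each add up to at most \<open>offs n\<close>.\<close>
  have "(\<Sum>a=0..<nn. deg (nonisolated ! a)) = (\<Sum>v\<in>set nonisolated. deg v)"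
    using distinct_nonisolated
    by (simp add: sum.distinct_set_conv_list sum_list_sum_nth)
  also have "\<dots> \<le> (\<Sum>v<n. deg v)"
    by (intro sum_mono2) (auto simp: nonisolated_def)
  finally have D: "(\<Sum>a=0..<nn. deg (nonisolated ! a)) \<le> offs n" by (simp add: offs_eq_sum)
  have "(\<Sum>a=0..<nn. 200 * ((k + 1) * (deg (nonisolated ! a) + 1)) + 11 + acost (Var ''nn'')) =
      200 * ((k + 1) * ((\<Sum>a=0..<nn. deg (nonisolated ! a)) + nn)) + 13 * nn"
    by (simp add: sum.distrib sum_distrib_left algebra_simps)
  also have "\<dots> \<le> 200 * ((k + 1) * (offs n + offs n)) + 13 * ((k + 1) * offs n)"
    using D nn_le by (intro add_mono mult_left_mono) (auto simp: algebra_simps)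
  finally have "t \<le> 20 + 413 * ((k + 1) * offs n)"
    using 6 by (auto simp: algebra_simps)
  also have "\<dots> \<le> 500 * ((k + 1) * (offs n + 1))" by (simp add: algebra_simps)
  finally show ?case using 6 by auto
qed (use assms in \<open>auto\<close>)

end

section \<open>Dynamic programming over sets of classes\<close>

text \<open>The recursion in terms of codes: removing a class subtracts a power of two, and the
  smaller code that results has its table entries filled already.\<close>

lemma set_decode_remove:
  assumes "i \<in> set_decode m"
  shows "2 ^ i \<le> m" "set_decode (m - 2 ^ i) = set_decode m - {i}"
proof -
  have "m = set_encode (set_decode m)" by simp
  also have "\<dots> = 2 ^ i + set_encode (set_decode m - {i})"
    unfolding set_encode_def using assms by (intro sum.remove) auto
  finally have m: "m = 2 ^ i + set_encode (set_decode m - {i})" .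
  then show "2 ^ i \<le> m" by linarith
  have "m - 2 ^ i = set_encode (set_decode m - {i})" using m by linarith
  then show "set_decode (m - 2 ^ i) = set_decode m - {i}" by simp
qed

lemma set_decode_less: "m < 2 ^ k \<Longrightarrow> set_decode m \<subseteq> {..<k}"
proof
  fix i assume "m < 2 ^ k" "i \<in> set_decode m"
  then have "(2::nat) ^ i < 2 ^ k" using set_decode_remove(1) by (meson le_less_trans)
  then show "i \<in> {..<k}" by simp
qed

lemma set_encode_less:
  assumes "S \<subseteq> {..<k}"
  shows "set_encode S < 2 ^ k"
proof -
  have "set_encode S \<le> (\<Sum>i\<in>{0..<k}. 2 ^ i)"
    unfolding set_encode_def using assms by (intro sum_mono2) auto
  also have "\<dots> < 2 ^ k" by (simp add: sum_power2)
  finally show ?thesis .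
qed

lemma set_decode_inject: "set_decode m = set_decode m' \<longleftrightarrow> m = m'"
  by (metis set_decode_inverse)

definition compute_powers :: com where
  "compute_powers = (Put ''pow'' (N 0) (N 1) ;; For ''i'' (N 0) (Var ''nk'')
     (Put ''pow'' (Plus (Var ''i'') (N 1)) (Plus (Get ''pow'' (Var ''i'')) (Get ''pow'' (Var ''i'')))))"

text \<open>Bits are found from the top down: once the higher ones are subtracted, bit
  \<open>i\<close> is absent iff the remainder is below \<open>pow[i]\<close>. The counter
  \<open>j\<close> runs upwards, hence the reversal \<open>nk - j - 1\<close>.\<close>

definition decode_mask :: com where
  "decode_mask = (''r'' ::= Var ''mask'' ;; For ''j'' (N 0) (Var ''nk'')
     (''i'' ::= Minus (Minus (Var ''nk'') (Var ''j'')) (N 1) ;;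
      IfElse (Less (Var ''r'') (Get ''pow'' (Var ''i'')))
        (Put ''bit'' (Var ''i'') (N 0))
        (''r'' ::= Minus (Var ''r'') (Get ''pow'' (Var ''i'')) ;; Put ''bit'' (Var ''i'') (N 1))))"

text \<open>Only entries at colors of nonisolated vertices are reset. These are the ones read
  afterwards, and the range of the colors is not bounded by the size of the graph.\<close>

definition init_rem :: com where
  "init_rem = For ''a'' (N 0) (Var ''nn'')
     (Put ''rem'' (Get ''col'' (Get ''nz'' (Var ''a''))) (Get ''mult'' (Get ''col'' (Get ''nz'' (Var ''a'')))))"

text \<open>
  \<open>def\<close> ends up as the number of elements of the motif not covered by the colors of the selected
  classes.
\<close>

definition subtract_colors :: com where
  "subtract_colors = (''def'' ::= Var ''msize'' ;; For ''a'' (N 0) (Var ''nn'')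
     (''v'' ::= Get ''nz'' (Var ''a'') ;;
      When (Conj (Equal (Get ''bit'' (Get ''cls'' (Var ''v''))) (N 1))
                 (Less (N 0) (Get ''rem'' (Get ''col'' (Var ''v'')))))
        (Put ''rem'' (Get ''col'' (Var ''v'')) (Minus (Get ''rem'' (Get ''col'' (Var ''v''))) (N 1)) ;;
         ''def'' ::= Minus (Var ''def'') (N 1))))"

text \<open>Here \<open>p\<close> is the code of \<open>S - {i}\<close>, hence \<open>p = 0\<close> iff \<open>S = {i}\<close>.\<close>

definition search_link :: com where
  "search_link = For ''e'' (Get ''off'' (Get ''rep'' (Var ''i''))) (Get ''off'' (Plus (Get ''rep'' (Var ''i'')) (N 1)))
     (When (Conj (Equal (Get ''bit'' (Get ''cls'' (Get ''adj'' (Var ''e'')))) (N 1))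
                 (Neg (Conj (Equal (Get ''cls'' (Get ''adj'' (Var ''e''))) (Var ''i''))
                            (Neg (Equal (Var ''p'') (N 0))))))
       (''acc'' ::= N 1))"

definition remove_class :: com where
  "remove_class =
     (''sz'' ::= Plus (Var ''sz'') (N 1) ;;
      ''p'' ::= Minus (Var ''mask'') (Get ''pow'' (Var ''i'')) ;;
      When (Equal (Get ''hallt'' (Var ''p'')) (N 0)) (''hall'' ::= N 0) ;;
      When (Equal (Get ''connt'' (Var ''p'')) (N 1))
        (When (Equal (Var ''p'') (N 0)) (''con'' ::= N 1) ;; search_link))"

definition combine_tables :: com where
  "combine_tables =
     (''sz'' ::= N 0 ;; ''hall'' ::= N 1 ;; ''con'' ::= N 0 ;; ''acc'' ::= N 0 ;;
      For ''i'' (N 0) (Var ''nk'') (When (Equal (Get ''bit'' (Var ''i'')) (N 1)) remove_class))"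

definition record_mask :: com where
  "record_mask =
     (When (Less (Var ''msize'') (Plus (Var ''sz'') (Var ''def''))) (''hall'' ::= N 0) ;;
      Put ''hallt'' (Var ''mask'') (Var ''hall'') ;;
      IfElse (Equal (Var ''con'') (N 1)) (Put ''connt'' (Var ''mask'') (N 1))
        (Put ''connt'' (Var ''mask'') (Var ''acc'')) ;;
      When (Conj (Equal (Var ''acc'') (N 1)) (Conj (Equal (Var ''hall'') (N 1)) (Equal (Var ''def'') (N 0))))
        (''out'' ::= N 1))"

definition process_mask :: com where
  "process_mask = (decode_mask ;; init_rem ;; subtract_colors ;; combine_tables ;; record_mask)"

definition enumerate_masks :: com where
  "enumerate_masks = (Put ''hallt'' (N 0) (N 1) ;; Put ''connt'' (N 0) (N 1) ;;
     For ''mask'' (N 1) (Get ''pow'' (Var ''nk'')) process_mask)"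

section \<open>Correctness and cost of the table computation\<close>

lemma wp_compute_powers:
  assumes "s ''nk'' 0 = K"
  shows "wp compute_powers (\<lambda>t s'. t \<le> 40 * (K + 1) \<and> eq_off {''i'', ''pow''} s s' \<and>
    (\<forall>i\<le>K. s' ''pow'' i = 2 ^ i)) s"
proof -
  let ?s = "upd s ''pow'' 0 1"
  have e: "upd s ''pow'' (aval (N 0) s) (aval (N 1) s) = ?s" by simp
  show ?thesis
    unfolding compute_powers_def wp_Seq wp_Put e
  proof (rule wp_For[where l = 0 and h = K and T = "\<lambda>_. 15" and I = "\<lambda>i s'. s' ''i'' 0 = i \<and>
      eq_off {''i'', ''pow''} s s' \<and> (\<forall>j\<le>i. s' ''pow'' j = 2 ^ j)"], goal_cases)
    case (3)
    then show ?case by (auto intro!: eq_off_upd)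
  next
    case (4 i s')
    then show ?case using assms eq_offD[of "{''i'', ''pow''}" s s'] by simp
  next
    case (5 i s')
    have "((s' ''pow'')(Suc i := s' ''pow'' i + s' ''pow'' i)) j = 2 ^ j" if "j \<le> Suc i" for j
      using 5 that by (cases "j = Suc i") auto
    then show ?case using 5 by (simp add: wp_simps eq_off_upd)
  next
    case (6 t s')
    then show ?case by (simp add: algebra_simps)
  qed simp_all
qed

locale classified_input =
  motif_input adj cs ms V E col M + twin_classes E "set (motif_input.nonisolated adj)" cls rep K
  for adj cs ms V E and col :: "nat \<Rightarrow> nat" and M cls rep K
begin

definition ready :: "state \<Rightarrow> bool" where
  "ready s \<longleftrightarrow> inputs s \<and> nonisolated_state s \<and> (\<forall>c. s ''mult'' c = count M c) \<and>
     s ''nk'' 0 = K \<and> s ''cls'' = cls \<and> s ''rep'' = rep \<and> (\<forall>i\<le>K. s ''pow'' i = 2 ^ i)"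

lemma readyD:
  assumes "ready s"
  shows "inputs s" "s ''nn'' 0 = nn" "a < nn \<Longrightarrow> s ''nz'' a = nonisolated ! a"
    "s ''mult'' c = count M c" "s ''nk'' 0 = K" "s ''cls'' = cls" "s ''rep'' = rep"
    "i \<le> K \<Longrightarrow> s ''pow'' i = 2 ^ i"
  using assms unfolding ready_def nonisolated_state_def by auto

text \<open>The arrays written while sets are enumerated. None of them occurs in
  \<open>ready\<close>, which therefore survives the whole enumeration.\<close>

definition work_vars :: "vname set" where
  "work_vars = {''r'', ''j'', ''i'', ''bit'', ''a'', ''rem'', ''def'', ''v'', ''sz'', ''p'', ''hall'',
     ''con'', ''e'', ''acc'', ''hallt'', ''connt'', ''out'', ''mask''}"

lemma ready_eq_off:
  assumes "ready s" "eq_off X s s'" "X \<subseteq> work_vars"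
  shows "ready s'"
proof -
  have fr: "eq_off work_vars s s'" using assms(2,3) unfolding eq_off_def by blast
  have "inputs s'"
    by (rule inputs_eq_off[OF readyD(1)[OF assms(1)] fr]) (simp add: work_vars_def)
  moreover have "s' y = s y" if "y \<in> {''nn'', ''nz'', ''mult'', ''nk'', ''cls'', ''rep'', ''pow''}" for y
    using that by (intro eq_offD[OF fr]) (auto simp: work_vars_def)
  ultimately show ?thesis
    using assms(1) by (simp add: ready_def nonisolated_state_def)
qed

lemma inj_rep: "inj_on rep {..<K}"
  by (rule inj_on_inverseI[where g = cls]) (simp add: rep_cls)

lemma K_le: "K \<le> nn"
proof -
  have "card {..<K} \<le> card (set nonisolated)"
    using rep_U inj_rep by (intro card_inj_on_le) auto
  then show ?thesis using distinct_nonisolated distinct_card by fastforce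
qed

text \<open>Representatives are distinct vertices, so scanning the adjacency lists of all of them
  costs \<open>O(|E|)\<close> per set of classes, not per class.\<close>

lemma sum_deg_rep: "(\<Sum>i<K. deg (rep i)) \<le> offs n"
proof -
  have "(\<Sum>i<K. deg (rep i)) = (\<Sum>v\<in>rep ` {..<K}. deg v)"
    by (simp add: sum.reindex inj_rep)
  also have "\<dots> \<le> (\<Sum>v<n. deg v)"
    using rep_U nonisolated_less by (intro sum_mono2) auto
  finally show ?thesis by (simp add: offs_eq_sum)
qed

definition decoded :: "nat set \<Rightarrow> state \<Rightarrow> bool" where
  "decoded S s \<longleftrightarrow> (\<forall>i<K. s ''bit'' i = (if i \<in> S then 1 else 0))"

lemma wp_decode_mask:
  assumes "ready s" "s ''mask'' 0 = m" "m < 2 ^ K"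
  shows "wp decode_mask (\<lambda>t s'. t \<le> 60 * (K + 1) \<and> eq_off {''r'', ''j'', ''i'', ''bit''} s s' \<and>
    decoded (set_decode m) s') s"
proof -
  let ?X = "{''r'', ''j'', ''i'', ''bit''}"
  let ?s = "upd s ''r'' 0 m"
  have e: "upd s ''r'' (aval (N 0) s) (aval (Var ''mask'') s) = ?s" using assms by simp
  show ?thesis
    unfolding decode_mask_def wp_Seq wp_Put[of "''r''" "N 0" "Var ''mask''"] e
  proof (rule wp_For[where l = 0 and h = K and T = "\<lambda>_. 40" and I = "\<lambda>j s'. s' ''j'' 0 = j \<and>
      eq_off ?X s s' \<and> s' ''r'' 0 = m mod 2 ^ (K - j) \<and>
      (\<forall>i<K. K - j \<le> i \<longrightarrow> s' ''bit'' i = (if i \<in> set_decode m then 1 else 0))"], goal_cases)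
    case 3
    then show ?case using assms by (auto intro!: eq_off_upd)
  next
    case (4 j s')
    then show ?case using readyD(5)[OF assms(1)] eq_offD[of ?X s s'] by simp
  next
    case (5 j s')
    then have fr: "eq_off ?X s s'" by blast
    then have rd: "ready s'" using ready_eq_off[OF assms(1)] by (simp add: work_vars_def)
    define i where "i = K - j - 1"
    have i: "K - j = Suc i" "K - Suc j = i" "i < K" using 5 by (auto simp: i_def)
    \<comment> \<open>The invariant keeps \<open>r\<close> equal to
      \<open>m mod 2 ^ (K - j)\<close>; this equation splits off its highest bit.\<close>
    have mod: "m mod 2 ^ Suc i = (if i \<in> set_decode m then 2 ^ i else 0) + m mod 2 ^ i"
      using mod_mult2_eq[of m "2 ^ i" 2]
      by (auto simp: set_decode_def mult.commute odd_iff_mod_2_eq_one)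
    have lt: "m mod 2 ^ i < 2 ^ i" by simp
    have r: "s' ''r'' 0 < 2 ^ i \<longleftrightarrow> i \<notin> set_decode m"
      "i \<in> set_decode m \<Longrightarrow> s' ''r'' 0 - 2 ^ i = m mod 2 ^ i"
      "i \<notin> set_decode m \<Longrightarrow> s' ''r'' 0 = m mod 2 ^ i"
      using 5 i mod lt by auto
    have pow: "s' ''pow'' i = 2 ^ i" "s' ''nk'' 0 = K" "s' ''j'' 0 = j"
      using readyD[OF rd] i 5 by auto
    have bits: "s' ''bit'' i' = (if i' \<in> set_decode m then 1 else 0)" if "i' < K" "i \<le> i'" "i' \<noteq> i" for i'
      using 5 that i by auto
    show ?case
      using pow r bits fr i unfolding wp_simps
      by (auto simp: i_def[symmetric] simp del: set_decode_0 set_decode_Suc intro!: eq_off_upd)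
  next
    case (6 t s')
    then show ?case by (auto simp: decoded_def)
  qed (use assms in \<open>auto simp: decoded_def\<close>)
qed

lemma wp_init_rem:
  assumes "ready s"
  shows "wp init_rem (\<lambda>t s'. t \<le> 40 * (nn + 1) \<and> eq_off {''a'', ''rem''} s s' \<and>
    (\<forall>v\<in>set nonisolated. s' ''rem'' (col v) = count M (col v))) s"
  unfolding init_rem_def
proof (rule wp_For[where l = 0 and h = nn and T = "\<lambda>_. 15" and I = "\<lambda>a s'. s' ''a'' 0 = a \<and>
    eq_off {''a'', ''rem''} s s' \<and>
    (\<forall>v\<in>set (take a nonisolated). s' ''rem'' (col v) = count M (col v))"], goal_cases)
  case (4 a s')
  then show ?case using readyD(2)[OF assms] eq_offD[of "{''a'', ''rem''}" s s'] by simp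
next
  case (5 a s')
  then have fr: "eq_off {''a'', ''rem''} s s'" by blast
  then have rd: "ready s'" using ready_eq_off[OF assms] by (simp add: work_vars_def)
  have v: "nonisolated ! a < n" using 5 nonisolated_less nth_mem by blast
  show ?case
    using 5 readyD[OF rd] inputsD(3)[OF readyD(1)[OF rd] v]
    by (auto simp: wp_simps take_Suc_conv_app_nth intro!: eq_off_upd)
qed (use assms in \<open>auto intro: eq_off_upd\<close>)

lemma members_mset:
  "mset_set (members S) = mset (filter (\<lambda>v. cls v \<in> S) nonisolated)"
proof -
  have "members S = set (filter (\<lambda>v. cls v \<in> S) nonisolated)" by (auto simp: members_def)
  then show ?thesis using distinct_nonisolated by (simp add: mset_set_set del: set_filter)
qed

text \<open>\<open>rem\<close> and \<open>def\<close> represent the difference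
  \<open>M - C a\<close>, with \<open>C a\<close> the selected colors seen so far. Multiset
  subtraction is truncated, and the test \<open>0 < rem\<close> reproduces this.\<close>

lemma wp_subtract_colors:
  assumes "ready s" "decoded S s" "S \<subseteq> {..<K}"
    and rem: "\<And>v. v \<in> set nonisolated \<Longrightarrow> s ''rem'' (col v) = count M (col v)"
  shows "wp subtract_colors (\<lambda>t s'. t \<le> 60 * (nn + 1) \<and> eq_off {''a'', ''rem'', ''def'', ''v''} s s' \<and>
    s' ''def'' 0 = size (M - image_mset col (mset_set (members S)))) s"
proof -
  let ?X = "{''a'', ''rem'', ''def'', ''v''}"
  let ?s = "upd s ''def'' 0 (size M)"
  have e: "upd s ''def'' (aval (N 0) s) (aval (Var ''msize'') s) = ?s"
    using inputsD(4)[OF readyD(1)[OF assms(1)]] by simp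
  define C where "C a = image_mset col (mset (filter (\<lambda>v. cls v \<in> S) (take a nonisolated)))" for a
  show ?thesis
    unfolding subtract_colors_def wp_Seq wp_Put[of "''def''" "N 0" "Var ''msize''"] e
  proof (rule wp_For[where l = 0 and h = nn and T = "\<lambda>_. 40" and I = "\<lambda>a s'. s' ''a'' 0 = a \<and>
      eq_off ?X s s' \<and> (\<forall>v\<in>set nonisolated. s' ''rem'' (col v) = count (M - C a) (col v)) \<and>
      s' ''def'' 0 = size (M - C a)"], goal_cases)
    case 3
    then show ?case using rem by (auto simp: C_def intro!: eq_off_upd)
  next
    case (4 a s')
    then show ?case using readyD(2)[OF assms(1)] eq_offD[of ?X s s'] by simp
  next
    case (5 a s')
    then have fr: "eq_off ?X s s'" by blast
    then have rd: "ready s'" using ready_eq_off[OF assms(1)] by (simp add: work_vars_def)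
    let ?v = "nonisolated ! a"
    have v: "?v \<in> set nonisolated" "?v < n" "s' ''col'' ?v = col ?v"
      using 5 nonisolated_less nth_mem inputsD(3)[OF readyD(1)[OF rd]] by blast+
    have bit: "s' ''bit'' (cls ?v) = (if cls ?v \<in> S then 1 else 0)"
      using assms(2) cls_less[OF v(1)] eq_offD[OF fr] by (simp add: decoded_def)
    have rem': "s' ''rem'' (col ?v) = count (M - C a) (col ?v)" using 5 v by blast
    have C: "C (Suc a) = (if cls ?v \<in> S then add_mset (col ?v) (C a) else C a)"
      using 5 by (simp add: C_def take_Suc_conv_app_nth)
    have split: "M - add_mset (col ?v) (C a) = M - C a - {#col ?v#}" by simp
    have sz: "size (M - C a - {#col ?v#}) = size (M - C a) - 1" if "0 < count (M - C a) (col ?v)"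
      using that by (intro size_Diff_singleton) (simp add: count_greater_zero_iff[symmetric] del: count_greater_zero_iff)
    have nop: "M - C a - {#col ?v#} = M - C a" if "\<not> 0 < count (M - C a) (col ?v)"
      using that by (intro diff_single_trivial) (simp add: count_greater_zero_iff[symmetric] del: count_greater_zero_iff)
    have rds: "s' ''nz'' a = ?v" "s' ''cls'' = cls" using readyD[OF rd] 5 by auto
    show ?case
    proof (cases "cls ?v \<in> S \<and> 0 < count (M - C a) (col ?v)")
      case True
      have "count (M - C (Suc a)) (col w) =
          (if col w = col ?v then count (M - C a) (col w) - 1 else count (M - C a) (col w))" for w
        using True by (simp only: C if_True split) simp
      moreover have "size (M - C (Suc a)) = size (M - C a) - 1"
        using True sz by (simp only: C if_True split)
      ultimately show ?thesis
        using True 5 v bit rem' rds unfolding wp_simps by (auto intro!: eq_off_upd)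
    next
      case False
      have "M - C (Suc a) = M - C a"
        using False nop by (cases "cls ?v \<in> S") (simp_all only: C if_True if_False split simp_thms)
      then show ?thesis
        using False 5 v bit rem' rds unfolding wp_simps by (auto intro!: eq_off_upd)
    qed
  next
    case (6 t s')
    then show ?case by (auto simp: C_def members_mset)
  qed (use assms in auto)
qed

definition tables :: "nat \<Rightarrow> state \<Rightarrow> bool" where
  "tables m s \<longleftrightarrow> (\<forall>m'<m.
     s ''hallt'' m' = (if feasible col M (set_decode m') then 1 else 0) \<and>
     s ''connt'' m' = (if grown class_adj (set_decode m') then 1 else 0))"

lemma tables_eq_off: "tables m s \<Longrightarrow> eq_off X s s' \<Longrightarrow> ''hallt'' \<notin> X \<Longrightarrow> ''connt'' \<notin> X \<Longrightarrow> tables m s'"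
  by (simp add: tables_def eq_off_def)

lemma decoded_eq_off: "decoded S s \<Longrightarrow> eq_off X s s' \<Longrightarrow> ''bit'' \<notin> X \<Longrightarrow> decoded S s'"
  by (simp add: decoded_def eq_off_def)

lemma wp_search_link:
  assumes rd: "ready s" and dec: "decoded S s" and i: "s ''i'' 0 = i" "i < K"
  shows "wp search_link (\<lambda>t s'. t \<le> 60 * (deg (rep i) + 1) \<and> eq_off {''e'', ''acc''} s s' \<and>
    s' ''acc'' 0 = (if \<exists>j\<in>S. class_adj i j \<and> (j \<noteq> i \<or> s ''p'' 0 = 0) then 1 else s ''acc'' 0)) s"
  unfolding search_link_def
proof (rule wp_search[where l = "offs (rep i)" and h = "offs (Suc (rep i))" and
    P = "\<lambda>e. cls (s ''adj'' e) \<in> S \<and> (cls (s ''adj'' e) \<noteq> i \<or> s ''p'' 0 = 0)"], goal_cases)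
  have r: "rep i < n" using rep_U[OF i(2)] nonisolated_less by blast
  {
    case 1
    then show ?case using readyD[OF rd] inputsD(2)[OF readyD(1)[OF rd]] i r by simp
  next
    case 2
    then show ?case using r by (rule offs_mono)
  next
    case (4 s')
    then have "ready s'" using ready_eq_off[OF rd] by (simp add: work_vars_def)
    then show ?case
      using readyD inputsD(2)[OF readyD(1)] i r eq_offD[OF 4] by simp
  next
    case (5 e s')
    \<comment> \<open>A neighbor of a representative is nonisolated itself, so its class index is
      below \<open>K\<close>, where \<open>decoded\<close> determines \<open>bit\<close>.\<close>
    have "s ''adj'' e \<in> neighborhood E (rep i)"
      using adj_range[OF readyD(1)[OF rd] r] 5 by auto
    then have "s ''adj'' e \<in> set nonisolated"
      using edge_nonisolated(1) by (simp add: neighborhood_def)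
    then have "s ''bit'' (cls (s ''adj'' e)) = (if cls (s ''adj'' e) \<in> S then 1 else 0)"
      using dec cls_less by (simp add: decoded_def)
    then show ?case using eq_offD[OF 5(1)] 5 readyD[OF rd] i by auto
  next
    case (6 t s')
    have "(\<exists>e\<in>{offs (rep i)..<offs (Suc (rep i))}.
          cls (s ''adj'' e) \<in> S \<and> (cls (s ''adj'' e) \<noteq> i \<or> s ''p'' 0 = 0)) \<longleftrightarrow>
        (\<exists>w\<in>neighborhood E (rep i). cls w \<in> S \<and> (cls w \<noteq> i \<or> s ''p'' 0 = 0))"
      by (rule bex_adj_range[OF readyD(1)[OF rd] r])
    also have "\<dots> \<longleftrightarrow> (\<exists>j\<in>S. class_adj i j \<and> (j \<noteq> i \<or> s ''p'' 0 = 0))"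
      unfolding class_adj_def by blast
    finally show ?case using 6 r by (simp add: offs_Suc)
  }
qed simp

definition links :: "nat set \<Rightarrow> nat \<Rightarrow> bool" where
  "links S i \<longleftrightarrow> grown class_adj (S - {i}) \<and> (\<exists>j\<in>S. class_adj i j \<and> (j \<noteq> i \<or> S = {i}))"

lemma wp_remove_class:
  assumes rd: "ready s" and dec: "decoded (set_decode m) s" and tab: "tables m s"
    and m: "s ''mask'' 0 = m" and i: "s ''i'' 0 = i" "i < K" "i \<in> set_decode m"
  shows "wp remove_class (\<lambda>t s'. t \<le> 150 * (deg (rep i) + 1) \<and>
    eq_off {''sz'', ''p'', ''hall'', ''con'', ''e'', ''acc''} s s' \<and>
    s' ''sz'' 0 = s ''sz'' 0 + 1 \<and>
    s' ''hall'' 0 = (if feasible col M (set_decode m - {i}) then s ''hall'' 0 else 0) \<and>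
    s' ''con'' 0 = (if set_decode m = {i} then 1 else s ''con'' 0) \<and>
    s' ''acc'' 0 = (if links (set_decode m) i then 1 else s ''acc'' 0)) s"
proof -
  let ?S = "set_decode m" and ?p = "m - 2 ^ i"
  let ?X = "{''sz'', ''p'', ''hall'', ''con'', ''e'', ''acc''}"
  have p: "2 ^ i \<le> m" "set_decode ?p = ?S - {i}" using set_decode_remove[OF i(3)] by auto
  have "?p < m" using p(1) by (meson diff_less less_le_trans zero_less_power pos2)
  then have t: "s ''hallt'' ?p = (if feasible col M (?S - {i}) then 1 else 0)"
      "s ''connt'' ?p = (if grown class_adj (?S - {i}) then 1 else 0)"
    using tab p(2) by (auto simp: tables_def)
  have pow: "s ''pow'' i = 2 ^ i" using readyD(8)[OF rd, of i] i by simp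
  have p0: "?p = 0 \<longleftrightarrow> ?S = {i}"
  proof -
    have "?p = 0 \<longleftrightarrow> set_decode ?p = {}" using set_decode_inject[of ?p 0] by simp
    then show ?thesis using p(2) i(3) by auto
  qed
  define s1 where "s1 = upd (upd s ''sz'' 0 (s ''sz'' 0 + 1)) ''p'' 0 ?p"
  define s2 where "s2 = (if feasible col M (?S - {i}) then s1 else upd s1 ''hall'' 0 0)"
  define s3 where "s3 = (if ?S = {i} then upd s2 ''con'' 0 1 else s2)"
  have fr3: "eq_off ?X s s3" and fr2: "eq_off ?X s s2"
    unfolding s3_def s2_def s1_def by (auto intro!: eq_off_upd)
  have s3: "s3 ''p'' 0 = ?p" "s3 ''acc'' 0 = s ''acc'' 0" "s3 ''sz'' 0 = s ''sz'' 0 + 1"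
    "s3 ''hall'' 0 = (if feasible col M (?S - {i}) then s ''hall'' 0 else 0)"
    "s3 ''con'' 0 = (if ?S = {i} then 1 else s ''con'' 0)"
    unfolding s3_def s2_def s1_def by auto
  have s2: "s2 ''p'' 0 = ?p" "s2 ''acc'' 0 = s ''acc'' 0" "s2 ''sz'' 0 = s ''sz'' 0 + 1"
    "s2 ''hall'' 0 = (if feasible col M (?S - {i}) then s ''hall'' 0 else 0)" "s2 ''con'' 0 = s ''con'' 0"
    "s2 ''connt'' = s ''connt''"
    unfolding s2_def s1_def by auto
  have link: "wp search_link (\<lambda>t s'. t \<le> 60 * (deg (rep i) + 1) \<and> eq_off {''e'', ''acc''} s3 s' \<and>
      s' ''acc'' 0 = (if \<exists>j\<in>?S. class_adj i j \<and> (j \<noteq> i \<or> ?S = {i}) then 1 else s ''acc'' 0)) s3"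
  proof -
    have p: "s3 ''p'' 0 = 0 \<longleftrightarrow> ?S = {i}" using p0 s3(1) by metis
    have "ready s3" using ready_eq_off[OF rd fr3] by (simp add: work_vars_def)
    moreover have "decoded ?S s3" using decoded_eq_off[OF dec fr3] by simp
    moreover have "s3 ''i'' 0 = i" using eq_offD[OF fr3] i by simp
    ultimately show ?thesis using wp_search_link[of s3 ?S i] i(2) unfolding p s3(2) by blast
  qed
  have e1: "upd (upd s ''sz'' (aval (N 0) s) (aval (Plus (Var ''sz'') (N 1)) s)) ''p''
      (aval (N 0) (upd s ''sz'' (aval (N 0) s) (aval (Plus (Var ''sz'') (N 1)) s)))
      (aval (Minus (Var ''mask'') (Get ''pow'' (Var ''i'')))
        (upd s ''sz'' (aval (N 0) s) (aval (Plus (Var ''sz'') (N 1)) s))) = s1"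
    using m i pow by (simp add: s1_def)
  have h1: "s1 ''p'' 0 = ?p" "s1 ''hallt'' = s ''hallt''" by (simp_all add: s1_def)
  have w2: "wp (When (Equal (Get ''hallt'' (Var ''p'')) (N 0)) (''hall'' ::= N 0)) (\<lambda>t s'. t \<le> 10 \<and> s' = s2) s1"
    unfolding wp_simps using t h1 by (auto simp: s2_def)
  have w3: "wp (When (Equal (Var ''p'') (N 0)) (''con'' ::= N 1)) (\<lambda>t s'. t \<le> 10 \<and> s' = s3) s2"
    unfolding wp_simps using p0 s2 by (auto simp: s3_def)
  show ?thesis
    unfolding remove_class_def wp_Seq wp_Put[of "''sz''"] wp_Put[of "''p''"] e1
  proof (rule wp_mono[OF w2], goal_cases)
    case (1 t1 s')
    then have s': "s' = s2" by simp
    show ?case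
    proof (cases "grown class_adj (?S - {i})")
      case True
      then have b: "bval (Equal (Get ''connt'' (Var ''p'')) (N 1)) s2" using s2 t by simp
      show ?thesis
        unfolding wp_IfElse[of "Equal (Get ''connt'' (Var ''p'')) (N 1)"] s' if_P[OF b] wp_Seq
      proof (rule wp_mono[OF w3], goal_cases)
        case (1 t2 s'')
        then have s'': "s'' = s3" by simp
        show ?case
          unfolding s''
        proof (rule wp_mono[OF link], goal_cases)
          case (1 t3 s4)
          then have fr4: "eq_off {''e'', ''acc''} s3 s4" by blast
          have "eq_off ?X s s4" by (rule eq_off_trans[OF fr3 fr4]) auto
          moreover have "links ?S i \<longleftrightarrow> (\<exists>j\<in>?S. class_adj i j \<and> (j \<noteq> i \<or> ?S = {i}))"
            using True by (simp add: links_def)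
          ultimately show ?case
            using 1 s3 eq_offD[OF fr4] \<open>t1 \<le> 10 \<and> _\<close> \<open>t2 \<le> 10 \<and> _\<close> by simp
        qed
      qed
    next
      case False
      then have b: "\<not> bval (Equal (Get ''connt'' (Var ''p'')) (N 1)) s2" using s2 t by simp
      \<comment> \<open>Removing \<open>i\<close> from \<open>{i}\<close> leaves the empty set,
        which is grown; so skipping this branch never misses a singleton, and \<open>con\<close> is
        rightly left alone.\<close>
      have "?S \<noteq> {i}" using False grown_empty[of class_adj] by auto
      moreover have "\<not> links ?S i" using False by (simp add: links_def)
      ultimately show ?thesis
        unfolding wp_IfElse s' if_not_P[OF b] wp_Skip using fr2 s2 1 by simp
    qed
  qed
qed

lemma linked_iff_links: "linked S \<longleftrightarrow> (\<exists>i\<in>S. links S i)"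
  by (simp add: linked_def links_def)

text \<open>The two notions differ only on singletons, which are always grown but linked only if the
  class is a clique. This is why the program keeps the flag \<open>con\<close> besides
  \<open>acc\<close>.\<close>

lemma grown_iff_linked: "S \<noteq> {} \<Longrightarrow> grown class_adj S \<longleftrightarrow> (\<exists>i\<in>S. S = {i}) \<or> linked S"
proof
  assume "S \<noteq> {}" "grown class_adj S"
  then obtain i where i: "i \<in> S" "grown class_adj (S - {i})" "S = {i} \<or> (\<exists>j\<in>S - {i}. class_adj i j)"
    using grown_iff[of S class_adj] by blast
  then show "(\<exists>i\<in>S. S = {i}) \<or> linked S" unfolding linked_def by blast
next
  assume "(\<exists>i\<in>S. S = {i}) \<or> linked S"
  then show "grown class_adj S"
    using linked_grown grown_insert[OF grown_empty] by fastforce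
qed

lemma wp_combine_tables:
  assumes rd: "ready s" and dec: "decoded (set_decode m) s" and tab: "tables m s"
    and m: "s ''mask'' 0 = m" "m < 2 ^ K"
  shows "wp combine_tables (\<lambda>t s'. t \<le> 400 * (offs n + 1) \<and>
    eq_off {''i'', ''sz'', ''p'', ''hall'', ''con'', ''e'', ''acc''} s s' \<and>
    s' ''sz'' 0 = card (set_decode m) \<and>
    s' ''hall'' 0 = (if \<forall>i\<in>set_decode m. feasible col M (set_decode m - {i}) then 1 else 0) \<and>
    s' ''con'' 0 = (if \<exists>i\<in>set_decode m. set_decode m = {i} then 1 else 0) \<and>
    s' ''acc'' 0 = (if linked (set_decode m) then 1 else 0)) s"
  unfolding combine_tables_def wp_Seq wp_Put aval.simps
proof (rule wp_For[where l = 0 and h = K and T = "\<lambda>i. 20 + 150 * (deg (rep i) + 1)" and I = "\<lambda>k s'.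
    s' ''i'' 0 = k \<and> eq_off {''i'', ''sz'', ''p'', ''hall'', ''con'', ''e'', ''acc''} s s' \<and>
    s' ''sz'' 0 = card (set_decode m \<inter> {..<k}) \<and>
    s' ''hall'' 0 = (if \<forall>i\<in>set_decode m \<inter> {..<k}. feasible col M (set_decode m - {i}) then 1 else 0) \<and>
    s' ''con'' 0 = (if \<exists>i\<in>set_decode m \<inter> {..<k}. set_decode m = {i} then 1 else 0) \<and>
    s' ''acc'' 0 = (if \<exists>i\<in>set_decode m \<inter> {..<k}. links (set_decode m) i then 1 else 0)"], goal_cases)
  case 3
  then show ?case by (simp add: eq_off_upd)
next
  case (4 k s')
  then have fr: "eq_off {''i'', ''sz'', ''p'', ''hall'', ''con'', ''e'', ''acc''} s s'" by blast
  show ?case using 4 readyD(5)[OF rd] eq_offD[OF fr] by simp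
next
  case (5 i s')
  let ?S = "set_decode m" and ?X = "{''i'', ''sz'', ''p'', ''hall'', ''con'', ''e'', ''acc''}"
  have fr: "eq_off ?X s s'" using 5 by blast
  have rd': "ready s'" using ready_eq_off[OF rd fr] by (simp add: work_vars_def)
  have dec': "decoded ?S s'" using decoded_eq_off[OF dec fr] by simp
  have tab': "tables m s'" using tables_eq_off[OF tab fr] by simp
  have m': "s' ''mask'' 0 = m" using eq_offD[OF fr] m by simp
  have i: "s' ''i'' 0 = i" "i < K" using 5 by blast+
  show ?case
  proof (cases "i \<in> ?S")
    case True
    have S: "?S \<inter> {..<Suc i} = insert i (?S \<inter> {..<i})" using True by auto
    have b: "bval (Equal (Get ''bit'' (Var ''i'')) (N 1)) s'"
      using dec' i True by (simp add: decoded_def)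
    show ?thesis
      unfolding wp_IfElse if_P[OF b]
    proof (rule wp_mono[OF wp_remove_class[OF rd' dec' tab' m' i True]], goal_cases)
      case (1 t s'')
      then have fr': "eq_off {''sz'', ''p'', ''hall'', ''con'', ''e'', ''acc''} s' s''" by blast
      have fr'': "eq_off ?X s s''" by (rule eq_off_trans[OF fr fr']) auto
      have "card (insert i (?S \<inter> {..<i})) = Suc (card (?S \<inter> {..<i}))" by simp
      then show ?case
        using 1 5 i eq_offD[OF fr'] unfolding S by (simp add: eq_off_upd[OF fr''])
    qed
  next
    case False
    have S: "?S \<inter> {..<Suc i} = ?S \<inter> {..<i}" using False by (auto simp: less_Suc_eq)
    have b: "\<not> bval (Equal (Get ''bit'' (Var ''i'')) (N 1)) s'"
      using dec' i False by (simp add: decoded_def)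
    show ?thesis
      unfolding wp_IfElse if_not_P[OF b] wp_Skip S using 5 by (simp add: eq_off_upd)
  qed
next
  case (6 t s')
  have S: "set_decode m \<inter> {..<K} = set_decode m" using set_decode_less[OF m(2)] by blast
  have "(\<Sum>i=0..<K. 20 + 150 * (deg (rep i) + 1) + 11 + acost (Var ''nk'')) =
      183 * K + 150 * (\<Sum>i<K. deg (rep i))"
    by (simp add: sum.distrib sum_distrib_left lessThan_atLeast0)
  moreover have "K \<le> offs n" using K_le nn_le by simp
  ultimately have "t + 40 \<le> 400 * (offs n + 1)"
    using 6(2) sum_deg_rep by simp
  then show ?case using 6(1) unfolding S by (simp add: linked_iff_links)
qed simp_all

lemma wp_process_mask:
  assumes rd: "ready s" and tab: "tables m s" and m: "s ''mask'' 0 = m" "0 < m" "m < 2 ^ K"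
  shows "wp process_mask (\<lambda>t s'. t \<le> 1000 * (offs n + 1) \<and> eq_off (work_vars - {''mask''}) s s' \<and>
    tables (Suc m) s' \<and> s' ''out'' 0 = (if accepts col M (set_decode m) then 1 else s ''out'' 0)) s"
  unfolding process_mask_def wp_Seq
proof (rule wp_mono[OF wp_decode_mask[OF rd m(1,3)]], goal_cases)
  case (1 t1 s1)
  let ?S = "set_decode m" and ?W = "work_vars - {''mask''}"
  have f1: "eq_off {''r'', ''j'', ''i'', ''bit''} s s1" and d1: "decoded ?S s1"
    and t1: "t1 \<le> 60 * (K + 1)" using 1 by blast+
  have rd1: "ready s1" using ready_eq_off[OF rd f1] by (simp add: work_vars_def)
  have f1': "eq_off ?W s s1" using f1 by (auto simp: eq_off_def work_vars_def)
  show ?case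
  proof (rule wp_mono[OF wp_init_rem[OF rd1]], goal_cases)
    case (1 t2 s2)
    have f2: "eq_off {''a'', ''rem''} s1 s2" and t2: "t2 \<le> 40 * (nn + 1)"
      and rem: "\<And>v. v \<in> set nonisolated \<Longrightarrow> s2 ''rem'' (col v) = count M (col v)"
      using 1 by blast+
    have rd2: "ready s2" using ready_eq_off[OF rd1 f2] by (simp add: work_vars_def)
    have d2: "decoded ?S s2" using decoded_eq_off[OF d1 f2] by simp
    have f2': "eq_off ?W s s2" by (rule eq_off_trans[OF f1' f2]) (auto simp: work_vars_def)
    show ?case
    proof (rule wp_mono[OF wp_subtract_colors[OF rd2 d2 set_decode_less[OF m(3)] rem]], goal_cases)
      case (2 t3 s3)
      let ?d = "size (M - image_mset col (mset_set (members ?S)))"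
      have f3: "eq_off {''a'', ''rem'', ''def'', ''v''} s2 s3" and t3: "t3 \<le> 60 * (nn + 1)"
        and def3: "s3 ''def'' 0 = ?d" using 2 by blast+
      have rd3: "ready s3" using ready_eq_off[OF rd2 f3] by (simp add: work_vars_def)
      have d3: "decoded ?S s3" using decoded_eq_off[OF d2 f3] by simp
      have f3': "eq_off ?W s s3" by (rule eq_off_trans[OF f2' f3]) (auto simp: work_vars_def)
      have tab3: "tables m s3"
        using tables_eq_off[OF tables_eq_off[OF tables_eq_off[OF tab f1] f2] f3] by simp
      have m3: "s3 ''mask'' 0 = m" using eq_offD[OF f3'] m(1) by simp
      have out3: "s3 ''out'' 0 = s ''out'' 0" using eq_offD[OF f3] eq_offD[OF f2] eq_offD[OF f1] by simp
      show ?case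
      proof (rule wp_mono[OF wp_combine_tables[OF rd3 d3 tab3 m3 m(3)]], goal_cases)
        case (1 t4 s4)
        have f4: "eq_off {''i'', ''sz'', ''p'', ''hall'', ''con'', ''e'', ''acc''} s3 s4"
          and t4: "t4 \<le> 400 * (offs n + 1)" and sz: "s4 ''sz'' 0 = card ?S"
          and hall: "s4 ''hall'' 0 = (if \<forall>i\<in>?S. feasible col M (?S - {i}) then 1 else 0)"
          and con: "s4 ''con'' 0 = (if \<exists>i\<in>?S. ?S = {i} then 1 else 0)"
          and acc: "s4 ''acc'' 0 = (if linked ?S then 1 else 0)"
          using 1 by blast+
        have rd4: "ready s4" using ready_eq_off[OF rd3 f4] by (simp add: work_vars_def)
        have f4': "eq_off ?W s s4" by (rule eq_off_trans[OF f3' f4]) (auto simp: work_vars_def)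
        have tab4: "tables m s4" using tables_eq_off[OF tab3 f4] by simp
        have s4: "s4 ''mask'' 0 = m" "s4 ''out'' 0 = s ''out'' 0" "s4 ''def'' 0 = ?d"
          "s4 ''msize'' 0 = size M"
          using eq_offD[OF f4] m3 out3 def3 inputsD(4)[OF readyD(1)[OF rd4]] by auto
        have "?S \<noteq> {}" using m(2) set_decode_inject[of m 0] by simp
        then have gr: "grown class_adj ?S \<longleftrightarrow> (\<exists>i\<in>?S. ?S = {i}) \<or> linked ?S"
          by (rule grown_iff_linked)
        have fe: "feasible col M ?S \<longleftrightarrow>
            \<not> size M < card ?S + ?d \<and> (\<forall>i\<in>?S. feasible col M (?S - {i}))"
          using feasible_iff[of ?S col M] by auto
        \<comment> \<open>The inclusion of \<open>M\<close> in the available colors is tested as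
          deficiency zero, at no extra cost.\<close>
        have ac: "accepts col M ?S \<longleftrightarrow> feasible col M ?S \<and> ?d = 0 \<and> linked ?S"
          by (auto simp: accepts_def Diff_eq_empty_iff_mset)
        have time: "t1 + t2 + t3 + t4 + 200 \<le> 1000 * (offs n + 1)"
          using t1 t2 t3 t4 K_le nn_le by simp
        have rec: "wp record_mask (\<lambda>t s'. t \<le> 60 \<and>
            eq_off {''hall'', ''hallt'', ''connt'', ''out''} s4 s' \<and>
            s' ''hallt'' = (s4 ''hallt'')(m := if feasible col M ?S then 1 else 0) \<and>
            s' ''connt'' = (s4 ''connt'')(m := if grown class_adj ?S then 1 else 0) \<and>
            s' ''out'' 0 = (if accepts col M ?S then 1 else s ''out'' 0)) s4"
        proof -
          define fs where "fs = (\<forall>i\<in>?S. feasible col M (?S - {i}))"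
          define sg where "sg = (\<exists>i\<in>?S. ?S = {i})"
          define s5 where "s5 = (if size M < card ?S + ?d then upd s4 ''hall'' 0 0 else s4)"
          have w: "wp (When (Less (Var ''msize'') (Plus (Var ''sz'') (Var ''def''))) (''hall'' ::= N 0))
              (\<lambda>t s'. t \<le> 15 \<and> s' = s5) s4"
            unfolding wp_simps using s4 sz by (simp add: s5_def)
          have s5: "s5 ''mask'' 0 = m" "s5 ''out'' 0 = s ''out'' 0" "s5 ''def'' 0 = ?d"
            "s5 ''hall'' 0 = (if feasible col M ?S then 1 else 0)"
            "s5 ''con'' 0 = (if sg then 1 else 0)" "s5 ''acc'' 0 = (if linked ?S then 1 else 0)"
            "s5 ''hallt'' = s4 ''hallt''" "s5 ''connt'' = s4 ''connt''"
            using s4 hall con acc fe by (auto simp: s5_def sg_def)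
          have f5: "eq_off {''hall'', ''hallt'', ''connt'', ''out''} s4 s5"
            by (simp add: s5_def eq_off_upd)
          show ?thesis
            unfolding record_mask_def wp_Seq
          proof (rule wp_mono[OF w], goal_cases)
            case (1 t s')
            then have s': "s' = s5" "t \<le> 15" by simp_all
            show ?case
              unfolding s'(1) wp_simps gr ac sg_def[symmetric]
              using s5 s'(2) f5 by (simp add: eq_off_upd)
          qed
        qed
        show ?case
        proof (rule wp_mono[OF rec], goal_cases)
          case (1 t5 s5)
          have f5: "eq_off {''hall'', ''hallt'', ''connt'', ''out''} s4 s5" using 1 by blast
          have "eq_off ?W s s5" by (rule eq_off_trans[OF f4' f5]) (auto simp: work_vars_def)
          moreover have "tables (Suc m) s5"
            using 1 tab4 unfolding tables_def by (simp add: less_Suc_eq)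
          moreover have "1 + t1 + (1 + t2 + (1 + t3 + (1 + t4 + t5))) \<le> 1000 * (offs n + 1)"
            using 1 time by linarith
          ultimately show ?case using 1 by blast
        qed
      qed
    qed
  qed
qed

lemma wp_enumerate_masks:
  assumes rd: "ready s" and out: "s ''out'' 0 = 0" and M: "2 \<le> size M"
  shows "wp enumerate_masks (\<lambda>t s'. t \<le> 1200 * (2 ^ K * (offs n + 1)) \<and>
    s' ''out'' 0 = (if graph_motif V E col M then 1 else 0)) s"
  unfolding enumerate_masks_def wp_Seq wp_Put aval.simps
proof (rule wp_For[where l = 1 and h = "2 ^ K" and T = "\<lambda>_. 1000 * (offs n + 1)" and I = "\<lambda>m s'.
    s' ''mask'' 0 = m \<and> eq_off work_vars s s' \<and> tables m s' \<and>
    s' ''out'' 0 = (if \<exists>m'\<in>{1..<m}. accepts col M (set_decode m') then 1 else 0)"], goal_cases)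
  case 3
  \<comment> \<open>The entries for code 0 are written before the loop: the empty set starts the
    recursion and is not itself a candidate.\<close>
  have "feasible col M {}" by (simp add: feasible_def members_def)
  then show ?case
    using out by (simp add: eq_off_upd work_vars_def tables_def grown_empty)
next
  case (4 m s')
  then have rd': "ready s'" using ready_eq_off[OF rd] by blast
  show ?case using 4 readyD(5)[OF rd'] readyD(8)[OF rd', of K] by simp
next
  case (5 m s')
  have fr: "eq_off work_vars s s'" and tab: "tables m s'" and m: "s' ''mask'' 0 = m" using 5 by blast+
  have rd': "ready s'" using ready_eq_off[OF rd fr] by blast
  have m': "0 < m" "m < 2 ^ K" using 5 by auto
  have iv: "{1..<Suc m} = insert m {1..<m}" using m' by auto
  show ?case
  proof (rule wp_mono[OF wp_process_mask[OF rd' tab m m']], goal_cases)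
    case (1 t s'')
    have fr': "eq_off (work_vars - {''mask''}) s' s''" using 1 by blast
    have fr'': "eq_off work_vars s s''" by (rule eq_off_trans[OF fr fr']) auto
    have "s'' ''mask'' 0 = m" using eq_offD[OF fr', of "''mask''"] m by simp
    moreover have "''mask'' \<in> work_vars" by (simp add: work_vars_def)
    ultimately show ?case
      using 1 5 unfolding iv by (simp add: eq_off_upd[OF fr''] tables_def)
  qed
next
  case (6 t s')
  have "(\<exists>m'\<in>{1..<2 ^ K}. accepts col M (set_decode m')) \<longleftrightarrow>
      (\<exists>S\<subseteq>{..<K}. S \<noteq> {} \<and> accepts col M S)"
  proof
    assume "\<exists>m'\<in>{1..<2 ^ K}. accepts col M (set_decode m')"
    then obtain m' where "m' \<in> {1..<2 ^ K}" "accepts col M (set_decode m')" by blast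
    moreover from this have "set_decode m' \<noteq> {}"
      using set_decode_inject[of m' 0] by auto
    ultimately show "\<exists>S\<subseteq>{..<K}. S \<noteq> {} \<and> accepts col M S"
      using set_decode_less[of m' K] by auto
  next
    assume "\<exists>S\<subseteq>{..<K}. S \<noteq> {} \<and> accepts col M S"
    then obtain S where S: "S \<subseteq> {..<K}" "S \<noteq> {}" "accepts col M S" by blast
    then have "finite S" using finite_subset by blast
    then have "set_decode (set_encode S) = S" by simp
    moreover from this have "set_encode S \<noteq> 0" using S(2) by (metis set_decode_zero)
    ultimately show "\<exists>m'\<in>{1..<2 ^ K}. accepts col M (set_decode m')"
      using S set_encode_less[OF S(1)] by (intro bexI[of _ "set_encode S"]) auto
  qed
  also have "\<dots> \<longleftrightarrow> graph_motif V E col M"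
    by (rule graph_motif_iff_accepts[symmetric, OF simple _ M]) (auto simp: set_nonisolated)
  finally have eq: "(\<exists>m'\<in>{1..<2 ^ K}. accepts col M (set_decode m')) \<longleftrightarrow> graph_motif V E col M" .
  let ?c = "1000 * (offs n + 1) + 11 + acost (Get ''pow'' (Var ''nk''))"
  have "(\<Sum>i\<in>{1..<(2::nat) ^ K}. ?c) = (2 ^ K - 1) * ?c" by simp
  also have "\<dots> \<le> 2 ^ K * ?c" by (rule mult_right_mono) auto
  finally have "t \<le> 8 + acost (N 1) + acost (Get ''pow'' (Var ''nk'')) + 2 ^ K * ?c"
    using 6(2) by linarith
  then have "t + 40 \<le> 80 + 2 ^ K * (1000 * (offs n + 1) + 14)" by simp
  also have "\<dots> \<le> 2 ^ K * 80 + 2 ^ K * (1000 * (offs n + 1) + 14)" by simp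
  also have "\<dots> \<le> 1200 * (2 ^ K * (offs n + 1))" by (simp add: algebra_simps)
  finally show ?case using 6(1) unfolding eq by simp
qed simp_all

end

section \<open>The complete algorithm\<close>

text \<open>The size tests precede \<open>count_motif\<close> because \<open>M\<close> may be much
  larger than the graph, while the time bound does not mention its size. A motif of size one may sit
  on an isolated vertex and is sought among all vertices; the empty motif leaves \<open>out\<close>
  at 0.\<close>

definition solve_graph_motif :: com where
  "solve_graph_motif =
     When (Less (N 0) (Var ''msize''))
       (IfElse (Equal (Var ''msize'') (N 1)) scan_motif
         (filter_isolated ;;
          When (Neg (Less (Var ''nn'') (Var ''msize'')))
            (count_motif ;; classify ;; compute_powers ;; enumerate_masks)))"

section \<open>Motifs of size at most one\<close>

lemma graph_motif_single:
  assumes "simple_graph V E" "size M = 1"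
  shows "graph_motif V E col M \<longleftrightarrow> (\<exists>v\<in>V. M = {#col v#})"
proof
  assume "graph_motif V E col M"
  then obtain W F where WF: "is_subgraph W F V E" "image_mset col (mset_set W) = M"
    unfolding graph_motif_def by blast
  then have "card W = 1" using assms(2) by auto
  then obtain v where "W = {v}" by (auto simp: card_1_singleton_iff)
  then show "\<exists>v\<in>V. M = {#col v#}" using WF unfolding is_subgraph_def by auto
next
  assume "\<exists>v\<in>V. M = {#col v#}"
  then obtain v where v: "v \<in> V" "M = {#col v#}" by blast
  then show "graph_motif V E col M"
    unfolding graph_motif_def
    by (intro exI[of _ "{v}"] exI[of _ "{}"])
      (auto simp: is_subgraph_def simple_graph_def connected_graph_def)
qed

lemma not_graph_motif_empty: "\<not> graph_motif V E col {#}"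
proof
  assume "graph_motif V E col {#}"
  then obtain W F where WF: "is_subgraph W F V E" "connected_graph W F" "mset_set W = {#}"
    unfolding graph_motif_def by auto
  then have "W = {}" unfolding is_subgraph_def simple_graph_def by (metis finite_set_mset_mset_set set_mset_empty)
  then show False using WF(2) by (simp add: connected_graph_def)
qed

context motif_input
begin

lemma classified_imp_locale:
  assumes "classified (set nonisolated) s"
  shows "classified_input adj cs ms V E col M (s ''cls'') (s ''rep'') (s ''nk'' 0)"
proof unfold_locales
  fix e assume "e \<in> E"
  then show "\<exists>u v. e = {u, v} \<and> u \<noteq> v \<and> u \<in> set nonisolated \<and> v \<in> set nonisolated"
    using edge_ends edge_nonisolated by metis
qed (use assms in \<open>auto simp: classified_def\<close>)

lemma motif_size_le:
  assumes "graph_motif V E col M" "2 \<le> size M"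
  shows "size M \<le> nn"
proof -
  obtain W F where WF: "is_subgraph W F V E" "connected_graph W F" "image_mset col (mset_set W) = M"
    using assms unfolding graph_motif_def by blast
  have F: "F \<subseteq> E" "\<And>e. e \<in> F \<Longrightarrow> e \<subseteq> W"
    using WF(1) unfolding is_subgraph_def simple_graph_def by auto
  have cW: "card W = size M" using WF(3) by auto
  have "W \<subseteq> set nonisolated"
  proof
    fix v assume "v \<in> W"
    then obtain u where "{v, u} \<in> F"
      using connected_graph_edge[of W F v] WF(2) F(2) cW assms(2) by auto
    then show "v \<in> set nonisolated" using F(1) edge_nonisolated(1) by blast
  qed
  then have "card W \<le> card (set nonisolated)" by (intro card_mono) auto
  then show ?thesis using cW distinct_nonisolated distinct_card by metis
qed

lemma inputs_init: "inputs (input_state adj cs ms)"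
  by (simp add: inputs_def)

lemma wp_solve_graph_motif:
  assumes k: "neighborhood_diversity_at_most V E k"
  shows "wp solve_graph_motif (\<lambda>t s. s ''out'' 0 = (if graph_motif V E col M then 1 else 0) \<and>
    t \<le> 10000 * (2 ^ k * card E + n + 1)) (input_state adj cs ms)"
proof -
  let ?s = "input_state adj cs ms"
  have zero: "?s y i = 0" if "y \<notin> {''n'', ''off'', ''adj'', ''col'', ''msize'', ''motif''}" for y i
    using that by (simp add: input_state_def)
  have msize: "?s ''msize'' 0 = size M" using inputsD(4)[OF inputs_init] .
  consider "size M = 0" | "size M = 1" | "2 \<le> size M" by linarith
  then show ?thesis
  proof cases
    case 1
    then show ?thesis
      unfolding solve_graph_motif_def using msize zero not_graph_motif_empty by (simp add: wp_simps)
  next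
    case 2
    then have b: "bval (Less (N 0) (Var ''msize'')) ?s" "bval (Equal (Var ''msize'') (N 1)) ?s"
      using msize by simp_all
    have z: "?s ''out'' 0 = 0" by (rule zero) simp
    show ?thesis
      unfolding solve_graph_motif_def wp_IfElse if_P[OF b(1)] if_P[OF b(2)]
    proof (rule wp_mono[OF wp_scan_motif[OF inputs_init 2 z]], goal_cases)
      case (1 t s)
      then show ?case using graph_motif_single[OF simple 2] by simp
    qed
  next
    case 3
    then have b: "bval (Less (N 0) (Var ''msize'')) ?s" "\<not> bval (Equal (Var ''msize'') (N 1)) ?s"
      using msize by simp_all
    have z: "?s ''nn'' 0 = 0" by (rule zero) simp
    show ?thesis
      unfolding solve_graph_motif_def wp_IfElse[of "Less (N 0) (Var ''msize'')"]
        wp_IfElse[of "Equal (Var ''msize'') (N 1)"] if_P[OF b(1)] if_not_P[OF b(2)] wp_Seq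
    proof (rule wp_mono[OF wp_filter_isolated[OF inputs_init z]], goal_cases)
      case (1 t1 s1)
      have f1: "eq_off {''v'', ''nn'', ''nz''} ?s s1" and nz1: "nonisolated_state s1"
        and t1: "t1 \<le> 40 * (n + 1)" using 1 by blast+
      have in1: "inputs s1" by (rule inputs_eq_off[OF inputs_init f1]) simp
      have s1: "s1 ''nn'' 0 = nn" "s1 ''msize'' 0 = size M"
        using nz1 inputsD(4)[OF in1] by (simp_all add: nonisolated_state_def)
      show ?case
      proof (cases "nn < size M")
        case True
        then have "\<not> graph_motif V E col M" using motif_size_le 3 by fastforce
        moreover have "s1 ''out'' 0 = 0" using eq_offD[OF f1] zero by simp
        ultimately show ?thesis
          unfolding wp_IfElse wp_Skip using True s1 t1 by simp
      next
        case False
        then have b: "bval (Neg (Less (Var ''nn'') (Var ''msize''))) s1" using s1 by simp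
        have z1: "s1 ''mult'' c = 0" for c using eq_offD[OF f1] zero by simp
        show ?thesis
          unfolding wp_IfElse if_P[OF b] wp_Seq
        proof (rule wp_mono[OF wp_count_motif[OF in1 z1]], goal_cases)
          case (1 t2 s2)
          have f2: "eq_off {''j'', ''mult''} s1 s2" and t2: "t2 \<le> 30 * (size M + 1)"
            and mult2: "\<And>c. s2 ''mult'' c = count M c" using 1 by blast+
          have in2: "inputs s2" by (rule inputs_eq_off[OF in1 f2]) simp
          have nz2: "nonisolated_state s2"
            using nz1 eq_offD[OF f2] by (simp add: nonisolated_state_def)
          have z2: "s2 ''nk'' 0 = 0" "\<And>w. s2 ''mark'' w = 0" "s2 ''out'' 0 = 0"
            using eq_offD[OF f2] eq_offD[OF f1] zero by simp_all
          show ?case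
          proof (rule wp_mono[OF wp_classify[OF in2 nz2 z2(1,2) k]], goal_cases)
            case (1 t3 s3)
            let ?X = "{''a'', ''v'', ''e'', ''mark'', ''cls'', ''i'', ''u'', ''ok'', ''rep'', ''nk''}"
            have f3: "eq_off ?X s2 s3" and t3: "t3 \<le> 500 * ((k + 1) * (offs n + 1))"
              and cl3: "classified (set nonisolated) s3" using 1 by blast+
            interpret classified_input adj cs ms V E col M "s3 ''cls''" "s3 ''rep''" "s3 ''nk'' 0"
              using classified_imp_locale[OF cl3] .
            let ?K = "s3 ''nk'' 0"
            have in3: "inputs s3" by (rule inputs_eq_off[OF in2 f3]) simp
            have Kk: "?K \<le> k" using classified_le[OF cl3 _ k] set_nonisolated by blast
            show ?case
            proof (rule wp_mono[OF wp_compute_powers[OF refl]], goal_cases)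
              case (1 t4 s4)
              have f4: "eq_off {''i'', ''pow''} s3 s4" and t4: "t4 \<le> 40 * (?K + 1)"
                and pow4: "\<forall>i\<le>?K. s4 ''pow'' i = 2 ^ i" using 1 by blast+
              have "inputs s4" by (rule inputs_eq_off[OF in3 f4]) simp
              then have rd: "ready s4"
                unfolding ready_def nonisolated_state_def
                using pow4 nz2 mult2 eq_offD[OF f4] eq_offD[OF f3] by (simp add: nonisolated_state_def)
              have z4: "s4 ''out'' 0 = 0" using z2(3) eq_offD[OF f4] eq_offD[OF f3] by simp
              show ?case
              proof (rule wp_mono[OF wp_enumerate_masks[OF rd z4 3]], goal_cases)
                case (1 t5 s5)
                let ?D = "2 ^ k * offs n"
                \<comment> \<open>In this branch there are at least \<open>size M \<ge> 2\<close>
                  nonisolated vertices, so \<open>offs n\<close> absorbs additive constants and the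
                  size of the motif.\<close>
                have D: "2 \<le> offs n" "size M \<le> offs n" "?K \<le> offs n"
                  using False 3 nn_le K_le by simp_all
                have "(1::nat) * offs n \<le> ?D" by (intro mult_right_mono) auto
                then have D': "offs n \<le> ?D" by simp
                \<comment> \<open>The classification costs a factor \<open>k + 1\<close>, which is
                  absorbed by \<open>2 ^ k\<close>.\<close>
                have "k + 1 \<le> 2 ^ k" using less_exp[of k] by (simp add: Suc_le_eq)
                then have "(k + 1) * (offs n + 1) \<le> 2 ^ k * (2 * offs n)"
                  using D by (intro mult_mono) auto
                then have t3': "t3 \<le> 1000 * ?D" using t3 by simp
                have "2 ^ ?K * (offs n + 1) \<le> 2 ^ k * (2 * offs n)"
                  using D Kk by (intro mult_mono) (auto intro: power_increasing)
                then have t5': "t5 \<le> 2400 * ?D" using 1 by simp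
                have "?D \<le> 2 * (2 ^ k * card E)" using offs_le_edges by simp
                \<comment> \<open>Naming the products \<open>x\<close> and \<open>y\<close> leaves
                  only linear arithmetic.\<close>
                moreover have "t1 + t2 + t3 + t4 + t5 + 200 \<le> 10000 * (y + n + 1)"
                    if "x \<le> 2 * y" "t3 \<le> 1000 * x" "t5 \<le> 2400 * x" "offs n \<le> x" for x y
                    using that t1 t2 t4 D by simp
                ultimately have "t1 + t2 + t3 + t4 + t5 + 200 \<le> 10000 * (2 ^ k * card E + n + 1)"
                  using t3' t5' D' by blast
                then show ?case using 1 by simp
              qed
            qed
          qed
        qed
      qed
    qed
  qed
qed

end

text \<open>The program and \<open>C\<close> are chosen before \<open>k\<close>, so they are uniform
  in it. The first bound excludes \<open>V = {}\<close> because its right-hand side is then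
  0.\<close>

theorem theorem3:
  shows "\<exists>(c::com) (C::real). \<forall>(k::nat) (V::nat set) (E::nat set set) (col::nat \<Rightarrow> nat)
      (M::nat multiset) (adj::nat list list) (cs::nat list) (ms::nat list).
    simple_graph V E \<longrightarrow>
    neighborhood_diversity_at_most V E k \<longrightarrow>
    encodes adj cs ms V E col M \<longrightarrow>
    (\<exists>t s. runs c (input_state adj cs ms) t s \<and>
       s ''out'' 0 = (if graph_motif V E col M then 1 else 0) \<and>
       (V \<noteq> {} \<and> no_isolated_vertices V E \<longrightarrow>
          real t \<le> C * (2 ^ k * sqrt (real (card V)) * real (card E))) \<and>
       real t \<le> C * (2 ^ k * sqrt (real (card V)) * real (card E) + real (card V) + 1))"
proof (intro exI[of _ solve_graph_motif] exI[of _ "50000::real"] allI impI)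
  fix k :: nat and V :: "nat set" and E and col :: "nat \<Rightarrow> nat" and M and adj :: "nat list list" and cs ms
  assume g: "simple_graph V E" "neighborhood_diversity_at_most V E k" "encodes adj cs ms V E col M"
  interpret motif_input adj cs ms V E col M using g by unfold_locales
  obtain t s where ts: "runs solve_graph_motif (input_state adj cs ms) t s"
      "s ''out'' 0 = (if graph_motif V E col M then 1 else 0)"
      "t \<le> 10000 * (2 ^ k * card E + n + 1)"
    using wp_solve_graph_motif[OF g(2)] unfolding wp_def by blast
  have cV: "card V = n" by (simp add: V_eq)
  let ?B = "2 ^ k * sqrt (real (card V)) * real (card E)"
  have "real t \<le> real (10000 * (2 ^ k * card E + n + 1))" using ts(3) by (rule of_nat_mono)
  then have t: "real t \<le> 10000 * (2 ^ k * real (card E) + real n + 1)" by simp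
  \<comment> \<open>As soon as there is an edge, \<open>V\<close> is nonempty and the square root is
    at least 1; without edges both sides vanish.\<close>
  have B: "2 ^ k * real (card E) \<le> ?B"
  proof (cases "card E = 0")
    case False
    then obtain e where "e \<in> E" by fastforce
    then have "0 < n" using edge_ends V_eq by fastforce
    then have "1 \<le> sqrt (real (card V))" unfolding cV by (simp add: Suc_le_eq)
    then have "2 ^ k * 1 * real (card E) \<le> ?B" by (intro mult_right_mono mult_left_mono) auto
    then show ?thesis by simp
  qed simp
  have "real t \<le> 50000 * ?B" if V: "V \<noteq> {}" "no_isolated_vertices V E"
  proof -
    have "set nonisolated = V"
      using V(2) unfolding set_nonisolated no_isolated_vertices_def by blast
    then have "n = nn" using cV distinct_nonisolated distinct_card by metis
    then have "n \<le> 2 * card E" using nn_le offs_le_edges by linarith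
    moreover have "0 < n" using V(1) V_eq by auto
    \<comment> \<open>From \<open>1 \<le> n\<close> and \<open>n \<le> 2 * card E\<close>. Together
      with the term \<open>2 ^ k * card E\<close> this gives five times 10000, the constant
      50000.\<close>
    ultimately have "real n + 1 \<le> 4 * real (card E)" by linarith
    moreover have "real (card E) \<le> 2 ^ k * real (card E)"
      using mult_right_mono[of 1 "2 ^ k" "real (card E)"] by simp
    moreover have "x \<le> 50000 * b" if "x \<le> 10000 * (a + y + 1)" "a \<le> b" "y + 1 \<le> 4 * e" "e \<le> a"
      for a b e x y :: real using that by simp
    ultimately show ?thesis using t B by blast
  qed
  moreover have "real t \<le> 50000 * (?B + real (card V) + 1)"
  proof -
    have bound: "x \<le> 50000 * (b + y + 1)" if "x \<le> 10000 * (a + y + 1)" "a \<le> b" "0 \<le> a" "0 \<le> y"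
      for a b x y :: real using that by simp
    show ?thesis unfolding cV by (rule bound[OF t B[unfolded cV]]) simp_all
  qed
  ultimately show "\<exists>t s. runs solve_graph_motif (input_state adj cs ms) t s \<and>
       s ''out'' 0 = (if graph_motif V E col M then 1 else 0) \<and>
       (V \<noteq> {} \<and> no_isolated_vertices V E \<longrightarrow> real t \<le> 50000 * ?B) \<and>
       real t \<le> 50000 * (?B + real (card V) + 1)"
    using ts by blast
qed

end
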